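(* Let $W\subset\mathbb C^d$ be an affine variety with ideal $\mathcal I_W\subset\mathbb C[x_1,\ldots,x_d]$, let $\mathfrak g$ be a Lie algebra, and let $\varrho\colon\mathfrak g\to\mathfrak X(W)$ be a Lie algebra morphism. (1) Any linear map $\widetilde\varrho\colon\mathfrak g\to\mathfrak X(\mathbb C^d)$ extending $\varrho$ is a weak symmetry action of $\mathfrak g$ on the singular foliation $\mathcal F=\mathcal I_W\mathfrak X(\mathbb C^d)$. (2) Let $p\in W$ be a fixed point of the $\mathfrak g$-action $\varrho$ which is also a strongly singular point of $W$. If the class $\mathrm{cl}(\eta|_p)\in H^2(\mathfrak g,\mathfrak g_p)$ does not vanish, then $\varrho\colon\mathfrak g\to\mathfrak X(W)$ cannot be extended to a Lie algebra morphism $\widetilde\varrho\colon\mathfrak g\to\mathfrak X(\mathbb C^d)$.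
   Context: $\mathfrak X(\mathbb C^d)=\mathrm{Der}(\mathbb C[x_1,\ldots,x_d])$, $\mathcal O_W=\mathbb C[x_1,\ldots,x_d]/\mathcal I_W$, $\mathfrak X(W)=\mathrm{Der}(\mathcal O_W)$. A linear map $\widetilde\varrho\colon\mathfrak g\to\mathfrak X(\mathbb C^d)$ extends $\varrho$ if each $\widetilde\varrho(x)$ satisfies $\widetilde\varrho(x)[\mathcal I_W]\subset\mathcal I_W$ and induces $\varrho(x)$ on $\mathcal O_W$; such linear extensions always exist. A weak symmetry action of $\mathfrak g$ on a singular foliation $\mathcal F\subset\mathfrak X(\mathbb C^d)$ is a linear map $\widetilde\varrho\colon\mathfrak g\to\mathfrak X(\mathbb C^d)$ with $[\widetilde\varrho(x),\mathcal F]\subseteq\mathcal F$ and $\widetilde\varrho([x,y]_{\mathfrak g})-[\widetilde\varrho(x),\widetilde\varrho(y)]\in\mathcal F$ for all $x,y\in\mathfrak g$. A point $p\in W$ is strongly singular if $\mathrm d_pf=0$ for all $f\in\mathcal I_W$. It is a fixed point of $\varrho$ if every vector field $\varrho(x)$, $x\in\mathfrak g$, vanishes at $p$. Let $\mathcal I_p$ be the ideal of polynomials vanishing at $p$. Since all elements of $\mathcal F=\mathcal I_W\mathfrak X(\mathbb C^d)$ vanish at $p\in W$, the isotropy Lie algebra of $\mathcal F$ at $p$ is $\mathfrak g_p=\mathcal F/\mathcal I_p\mathcal F$; it is Abelian when $p$ is strongly singular. For $p$ a strongly singular fixed point, and $\widetilde\varrho$ any linear extension of $\varrho$, $\mathfrak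 g_p$ is a $\mathfrak g$-module via $x\cdot\overline X=\overline{[\widetilde\varrho(x),X]}$, and $\eta|_p\colon\wedge^2\mathfrak g\to\mathfrak g_p$, $\eta|_p(x,y)=\overline{\widetilde\varrho([x,y]_{\mathfrak g})-[\widetilde\varrho(x),\widetilde\varrho(y)]}$, is a Chevalley–Eilenberg $2$-cocycle; $\mathrm{cl}(\eta|_p)\in H^2(\mathfrak g,\mathfrak g_p)$ is its class, which does not depend on the choice of $\widetilde\varrho$. *)

theory Defs
  imports
    "HOL-Algebra.QuotRing"
    "HOL-Algebra.Module"
    "HOL-Algebra.Algebraic_Closure_Type"
    "HOL-Library.Poly_Mapping"
    "HOL-Analysis.Finite_Cartesian_Product"
begin

section \<open>Linear maps and quotients\<close>

definition linear_maps ::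
  "('k, 'c) ring_scheme \<Rightarrow> ('k, 'a, 'm) module_scheme \<Rightarrow> ('k, 'b, 'l) module_scheme \<Rightarrow> ('a \<Rightarrow> 'b) set"
  where "linear_maps K V U =
    {\<phi> \<in> carrier V \<rightarrow> carrier U.
       (\<forall>v\<in>carrier V. \<forall>w\<in>carrier V. \<phi> (v \<oplus>\<^bsub>V\<^esub> w) = \<phi> v \<oplus>\<^bsub>U\<^esub> \<phi> w) \<and>
       (\<forall>c\<in>carrier K. \<forall>v\<in>carrier V. \<phi> (c \<odot>\<^bsub>V\<^esub> v) = c \<odot>\<^bsub>U\<^esub> \<phi> v)}"

text \<open>\<open>FactRing\<close> with scalar multiplication. It serves both as the quotient of an algebra by an
  ideal and as the quotient of a module by a submodule; in the latter case the two
  multiplicative fields carry no meaning.\<close>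

definition quot_module ::
  "('k, 'a, 'm) module_scheme \<Rightarrow> 'a set \<Rightarrow> ('k, 'a set) module"
  where "quot_module M N =
    \<lparr>carrier = carrier (M Quot N), monoid.mult = monoid.mult (M Quot N), one = one (M Quot N),
     zero = zero (M Quot N), add = add (M Quot N),
     module.smult = (\<lambda>c A. \<Union>a\<in>A. N +>\<^bsub>M\<^esub> (c \<odot>\<^bsub>M\<^esub> a))\<rparr>"


section \<open>Lie algebras\<close>

text \<open>The fields \<open>mult\<close> and \<open>one\<close> inherited from the module record are irrelevant.\<close>

record ('k, 'g) lie_struct = "('k, 'g) module" +
  lie_bracket :: "'g \<Rightarrow> 'g \<Rightarrow> 'g"

locale lie_algebra = field K + module K L
  for K :: "('k, 'c) ring_scheme" and L :: "('k, 'g, 'm) lie_struct_scheme" +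
  assumes bracket_closed:
      "\<lbrakk>x \<in> carrier L; y \<in> carrier L\<rbrakk> \<Longrightarrow> lie_bracket L x y \<in> carrier L"
    and bracket_add_left:
      "\<lbrakk>x \<in> carrier L; y \<in> carrier L; z \<in> carrier L\<rbrakk>
       \<Longrightarrow> lie_bracket L (x \<oplus>\<^bsub>L\<^esub> y) z = lie_bracket L x z \<oplus>\<^bsub>L\<^esub> lie_bracket L y z"
    and bracket_add_right:
      "\<lbrakk>x \<in> carrier L; y \<in> carrier L; z \<in> carrier L\<rbrakk>
       \<Longrightarrow> lie_bracket L x (y \<oplus>\<^bsub>L\<^esub> z) = lie_bracket L x y \<oplus>\<^bsub>L\<^esub> lie_bracket L x z"
    and bracket_smult_left:
      "\<lbrakk>c \<in> carrier K; x \<in> carrier L; y \<in> carrier L\<rbrakk>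
       \<Longrightarrow> lie_bracket L (c \<odot>\<^bsub>L\<^esub> x) y = c \<odot>\<^bsub>L\<^esub> lie_bracket L x y"
    and bracket_smult_right:
      "\<lbrakk>c \<in> carrier K; x \<in> carrier L; y \<in> carrier L\<rbrakk>
       \<Longrightarrow> lie_bracket L x (c \<odot>\<^bsub>L\<^esub> y) = c \<odot>\<^bsub>L\<^esub> lie_bracket L x y"
    and bracket_self:
      "x \<in> carrier L \<Longrightarrow> lie_bracket L x x = \<zero>\<^bsub>L\<^esub>"
    and jacobi:
      "\<lbrakk>x \<in> carrier L; y \<in> carrier L; z \<in> carrier L\<rbrakk>
       \<Longrightarrow> lie_bracket L x (lie_bracket L y z) \<oplus>\<^bsub>L\<^esub>
           (lie_bracket L y (lie_bracket L z x) \<oplus>\<^bsub>L\<^esub> lie_bracket L z (lie_bracket L x y)) = \<zero>\<^bsub>L\<^esub>"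

definition lie_hom ::
  "('k, 'c) ring_scheme \<Rightarrow> ('k, 'a, 'm) lie_struct_scheme \<Rightarrow> ('k, 'b, 'l) lie_struct_scheme \<Rightarrow> ('a \<Rightarrow> 'b) set"
  where "lie_hom K L H =
    {\<phi> \<in> linear_maps K L H. \<forall>x\<in>carrier L. \<forall>y\<in>carrier L.
       \<phi> (lie_bracket L x y) = lie_bracket H (\<phi> x) (\<phi> y)}"


section \<open>Derivations of a commutative algebra\<close>

text \<open>Derivations are extensional functions, so that equality of derivations is equality on the
  carrier.\<close>

definition derivations ::
  "('k, 'c) ring_scheme \<Rightarrow> ('k, 'a, 'm) module_scheme \<Rightarrow> ('a \<Rightarrow> 'a) set"
  where "derivations K A =
    {D \<in> linear_maps K A A \<inter> extensional (carrier A).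
       \<forall>a\<in>carrier A. \<forall>b\<in>carrier A. D (a \<otimes>\<^bsub>A\<^esub> b) = D a \<otimes>\<^bsub>A\<^esub> b \<oplus>\<^bsub>A\<^esub> a \<otimes>\<^bsub>A\<^esub> D b}"

definition Der ::
  "('k, 'c) ring_scheme \<Rightarrow> ('k, 'a, 'm) module_scheme \<Rightarrow> ('k, 'a \<Rightarrow> 'a) lie_struct"
  where "Der K A =
    \<lparr>carrier = derivations K A, monoid.mult = undefined, one = undefined,
     zero = (\<lambda>a\<in>carrier A. \<zero>\<^bsub>A\<^esub>),
     add = (\<lambda>D E. \<lambda>a\<in>carrier A. D a \<oplus>\<^bsub>A\<^esub> E a),
     module.smult = (\<lambda>c D. \<lambda>a\<in>carrier A. c \<odot>\<^bsub>A\<^esub> D a),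
     lie_bracket = (\<lambda>D E. \<lambda>a\<in>carrier A. D (E a) \<ominus>\<^bsub>A\<^esub> E (D a))\<rparr>"

text \<open>The product \<open>I N\<close> of an ideal \<open>I\<close> of \<open>A\<close> with a nonempty set \<open>N\<close> of derivations: all finite
  sums of products \<open>f D\<close>. Compare \<open>ideal_prod\<close>.\<close>

inductive_set ideal_der_prod ::
  "('k, 'c) ring_scheme \<Rightarrow> ('k, 'a, 'm) module_scheme \<Rightarrow> 'a set \<Rightarrow> ('a \<Rightarrow> 'a) set \<Rightarrow> ('a \<Rightarrow> 'a) set"
  for K and A and I and N where
    prod: "\<lbrakk>f \<in> I; D \<in> N\<rbrakk> \<Longrightarrow> (\<lambda>a\<in>carrier A. f \<otimes>\<^bsub>A\<^esub> D a) \<in> ideal_der_prod K A I N"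
  | sum: "\<lbrakk>D \<in> ideal_der_prod K A I N; E \<in> ideal_der_prod K A I N\<rbrakk>
          \<Longrightarrow> D \<oplus>\<^bsub>Der K A\<^esub> E \<in> ideal_der_prod K A I N"


section \<open>Chevalley--Eilenberg cohomology in degree two\<close>

text \<open>\<open>act\<close> is the action of the Lie algebra \<open>L\<close> on the module \<open>M\<close>. As for derivations,
  2-cochains are extensional.\<close>

definition ce_cochains2 ::
  "('k, 'c) ring_scheme \<Rightarrow> ('k, 'g, 'm) lie_struct_scheme \<Rightarrow> ('k, 'v, 'l) module_scheme
   \<Rightarrow> ('k, 'g \<Rightarrow> 'g \<Rightarrow> 'v) module"
  where "ce_cochains2 K L M =
    \<lparr>carrier = {\<omega> \<in> carrier L \<rightarrow>\<^sub>E (carrier L \<rightarrow>\<^sub>E carrier M).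
        (\<forall>x\<in>carrier L. \<omega> x \<in> linear_maps K L M) \<and>
        (\<forall>y\<in>carrier L. (\<lambda>x. \<omega> x y) \<in> linear_maps K L M) \<and>
        (\<forall>x\<in>carrier L. \<omega> x x = \<zero>\<^bsub>M\<^esub>)},
     monoid.mult = undefined, one = undefined,
     zero = (\<lambda>x\<in>carrier L. \<lambda>y\<in>carrier L. \<zero>\<^bsub>M\<^esub>),
     add = (\<lambda>\<omega> \<theta>. \<lambda>x\<in>carrier L. \<lambda>y\<in>carrier L. \<omega> x y \<oplus>\<^bsub>M\<^esub> \<theta> x y),
     module.smult = (\<lambda>c \<omega>. \<lambda>x\<in>carrier L. \<lambda>y\<in>carrier L. c \<odot>\<^bsub>M\<^esub> \<omega> x y)\<rparr>"

definition ce_d1 ::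
  "('k, 'g, 'm) lie_struct_scheme \<Rightarrow> ('k, 'v, 'l) module_scheme \<Rightarrow> ('g \<Rightarrow> 'v \<Rightarrow> 'v)
   \<Rightarrow> ('g \<Rightarrow> 'v) \<Rightarrow> 'g \<Rightarrow> 'g \<Rightarrow> 'v"
  where "ce_d1 L M act \<beta> =
    (\<lambda>x\<in>carrier L. \<lambda>y\<in>carrier L.
       act x (\<beta> y) \<ominus>\<^bsub>M\<^esub> act y (\<beta> x) \<ominus>\<^bsub>M\<^esub> \<beta> (lie_bracket L x y))"

definition ce_d2 ::
  "('k, 'g, 'm) lie_struct_scheme \<Rightarrow> ('k, 'v, 'l) module_scheme \<Rightarrow> ('g \<Rightarrow> 'v \<Rightarrow> 'v)
   \<Rightarrow> ('g \<Rightarrow> 'g \<Rightarrow> 'v) \<Rightarrow> 'g \<Rightarrow> 'g \<Rightarrow> 'g \<Rightarrow> 'v"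
  where "ce_d2 L M act \<omega> =
    (\<lambda>x\<in>carrier L. \<lambda>y\<in>carrier L. \<lambda>z\<in>carrier L.
       act x (\<omega> y z) \<ominus>\<^bsub>M\<^esub> act y (\<omega> x z) \<oplus>\<^bsub>M\<^esub> act z (\<omega> x y)
       \<ominus>\<^bsub>M\<^esub> \<omega> (lie_bracket L x y) z \<oplus>\<^bsub>M\<^esub> \<omega> (lie_bracket L x z) y
       \<ominus>\<^bsub>M\<^esub> \<omega> (lie_bracket L y z) x)"

definition ce_cocycles2 ::
  "('k, 'c) ring_scheme \<Rightarrow> ('k, 'g, 'm) lie_struct_scheme \<Rightarrow> ('k, 'v, 'l) module_scheme
   \<Rightarrow> ('g \<Rightarrow> 'v \<Rightarrow> 'v) \<Rightarrow> ('g \<Rightarrow> 'g \<Rightarrow> 'v) set"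
  where "ce_cocycles2 K L M act =
    {\<omega> \<in> carrier (ce_cochains2 K L M).
       \<forall>x\<in>carrier L. \<forall>y\<in>carrier L. \<forall>z\<in>carrier L. ce_d2 L M act \<omega> x y z = \<zero>\<^bsub>M\<^esub>}"

definition ce_coboundaries2 ::
  "('k, 'c) ring_scheme \<Rightarrow> ('k, 'g, 'm) lie_struct_scheme \<Rightarrow> ('k, 'v, 'l) module_scheme
   \<Rightarrow> ('g \<Rightarrow> 'v \<Rightarrow> 'v) \<Rightarrow> ('g \<Rightarrow> 'g \<Rightarrow> 'v) set"
  where "ce_coboundaries2 K L M act = ce_d1 L M act ` linear_maps K L M"

definition ce_H2 ::
  "('k, 'c) ring_scheme \<Rightarrow> ('k, 'g, 'm) lie_struct_scheme \<Rightarrow> ('k, 'v, 'l) module_scheme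
   \<Rightarrow> ('g \<Rightarrow> 'v \<Rightarrow> 'v) \<Rightarrow> ('k, ('g \<Rightarrow> 'g \<Rightarrow> 'v) set) module"
  where "ce_H2 K L M act =
    quot_module ((ce_cochains2 K L M)\<lparr>carrier := ce_cocycles2 K L M act\<rparr>)
      (ce_coboundaries2 K L M act)"

definition ce_class2 ::
  "('k, 'c) ring_scheme \<Rightarrow> ('k, 'g, 'm) lie_struct_scheme \<Rightarrow> ('k, 'v, 'l) module_scheme
   \<Rightarrow> ('g \<Rightarrow> 'v \<Rightarrow> 'v) \<Rightarrow> ('g \<Rightarrow> 'g \<Rightarrow> 'v) \<Rightarrow> ('g \<Rightarrow> 'g \<Rightarrow> 'v) set"
  where "ce_class2 K L M act \<omega> =
    ce_coboundaries2 K L M act +>\<^bsub>ce_cochains2 K L M\<^esub> \<omega>"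


section \<open>Affine varieties and vector fields on them\<close>

abbreviation CC :: "complex ring"
  where "CC \<equiv> ring_of_type_algebra"

text \<open>Polynomials in the variables indexed by \<open>'n\<close>: finitely supported coefficient functions on
  exponent vectors, with the convolution product.\<close>

type_synonym 'n cpoly = "('n \<Rightarrow>\<^sub>0 nat) \<Rightarrow>\<^sub>0 complex"

definition poly_eval :: "'n::finite cpoly \<Rightarrow> complex ^ 'n \<Rightarrow> complex"
  where "poly_eval f p =
    (\<Sum>m\<in>Poly_Mapping.keys f. Poly_Mapping.lookup f m * (\<Prod>i\<in>UNIV. (p $ i) ^ Poly_Mapping.lookup m i))"

definition poly_algebra :: "(complex, 'n::finite cpoly) module"
  where "poly_algebra =
    \<lparr>carrier = UNIV, monoid.mult = (*), one = 1, zero = 0, add = (+),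
     module.smult = (\<lambda>c f. Poly_Mapping.single 0 c * f)\<rparr>"

definition affine_variety :: "(complex ^ 'n::finite) set \<Rightarrow> bool"
  where "affine_variety W \<longleftrightarrow> (\<exists>S. W = {p. \<forall>f\<in>S. poly_eval f p = 0})"

definition vanishing_ideal :: "(complex ^ 'n::finite) set \<Rightarrow> 'n cpoly set"
  where "vanishing_ideal W = {f. \<forall>p\<in>W. poly_eval f p = 0}"

definition coord_ring :: "(complex ^ 'n::finite) set \<Rightarrow> (complex, 'n cpoly set) module"
  where "coord_ring W = quot_module poly_algebra (vanishing_ideal W)"

abbreviation vector_fields :: "(complex, 'n::finite cpoly \<Rightarrow> 'n cpoly) lie_struct"
  where "vector_fields \<equiv> Der CC poly_algebra"

abbreviation vector_fields_on ::
  "(complex ^ 'n::finite) set \<Rightarrow> (complex, 'n cpoly set \<Rightarrow> 'n cpoly set) lie_struct"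
  where "vector_fields_on W \<equiv> Der CC (coord_ring W)"

definition extends ::
  "(complex ^ 'n::finite) set \<Rightarrow> (complex, 'g, 'm) lie_struct_scheme
   \<Rightarrow> ('g \<Rightarrow> 'n cpoly set \<Rightarrow> 'n cpoly set) \<Rightarrow> ('g \<Rightarrow> 'n cpoly \<Rightarrow> 'n cpoly) \<Rightarrow> bool"
  where "extends W L \<rho> \<rho>' \<longleftrightarrow>
    (\<forall>x\<in>carrier L.
       \<rho>' x ` vanishing_ideal W \<subseteq> vanishing_ideal W \<and>
       (\<forall>f. \<rho> x (vanishing_ideal W +>\<^bsub>poly_algebra\<^esub> f) = vanishing_ideal W +>\<^bsub>poly_algebra\<^esub> \<rho>' x f))"

definition weak_symmetry_action ::
  "(complex, 'g, 'm) lie_struct_scheme \<Rightarrow> ('n::finite cpoly \<Rightarrow> 'n cpoly) set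
   \<Rightarrow> ('g \<Rightarrow> 'n cpoly \<Rightarrow> 'n cpoly) \<Rightarrow> bool"
  where "weak_symmetry_action L \<F> \<rho>' \<longleftrightarrow>
    \<rho>' \<in> linear_maps CC L vector_fields \<and>
    (\<forall>x\<in>carrier L. \<forall>D\<in>\<F>. lie_bracket vector_fields (\<rho>' x) D \<in> \<F>) \<and>
    (\<forall>x\<in>carrier L. \<forall>y\<in>carrier L.
       \<rho>' (lie_bracket L x y) \<ominus>\<^bsub>vector_fields\<^esub> lie_bracket vector_fields (\<rho>' x) (\<rho>' y) \<in> \<F>)"

definition vanishing_foliation ::
  "(complex ^ 'n::finite) set \<Rightarrow> ('n cpoly \<Rightarrow> 'n cpoly) set"
  where "vanishing_foliation W =
    ideal_der_prod CC poly_algebra (vanishing_ideal W) (carrier vector_fields)"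

text \<open>The differential is the Frechet derivative of the polynomial function over the reals, which
  is zero if and only if the complex differential is.\<close>

definition strongly_singular :: "(complex ^ 'n::finite) set \<Rightarrow> complex ^ 'n \<Rightarrow> bool"
  where "strongly_singular W p \<longleftrightarrow>
    p \<in> W \<and> (\<forall>f\<in>vanishing_ideal W. (poly_eval f has_derivative (\<lambda>_. 0)) (at p))"

text \<open>A vector field \<open>D\<close> on \<open>W\<close> vanishes at \<open>p \<in> W\<close> if \<open>D a\<close> does for all \<open>a\<close> in the
  coordinate ring. As \<open>D a\<close> is a coset of the vanishing ideal, all its representatives have the
  same value at \<open>p\<close>.\<close>

definition fixed_point ::
  "(complex ^ 'n::finite) set \<Rightarrow> (complex, 'g, 'm) lie_struct_scheme
   \<Rightarrow> ('g \<Rightarrow> 'n cpoly set \<Rightarrow> 'n cpoly set) \<Rightarrow> complex ^ 'n \<Rightarrow> bool"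
  where "fixed_point W L \<rho> p \<longleftrightarrow>
    p \<in> W \<and> (\<forall>x\<in>carrier L. \<forall>a\<in>carrier (coord_ring W). \<forall>f\<in>\<rho> x a. poly_eval f p = 0)"


section \<open>The isotropy Lie algebra and the obstruction class\<close>

text \<open>The submodule \<open>\<I>\<^sub>p \<F>\<close>.\<close>

definition isotropy_kernel ::
  "('n::finite cpoly \<Rightarrow> 'n cpoly) set \<Rightarrow> complex ^ 'n \<Rightarrow> ('n cpoly \<Rightarrow> 'n cpoly) set"
  where "isotropy_kernel \<F> p = ideal_der_prod CC poly_algebra (vanishing_ideal {p}) \<F>"

text \<open>Only the vector space underlying the isotropy Lie algebra; its bracket is zero in the
  case of interest and enters neither the action nor the cohomology.\<close>

definition isotropy ::
  "('n::finite cpoly \<Rightarrow> 'n cpoly) set \<Rightarrow> complex ^ 'n \<Rightarrow> (complex, ('n cpoly \<Rightarrow> 'n cpoly) set) module"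
  where "isotropy \<F> p = quot_module (vector_fields\<lparr>carrier := \<F>\<rparr>) (isotropy_kernel \<F> p)"

definition isotropy_action ::
  "('n::finite cpoly \<Rightarrow> 'n cpoly) set \<Rightarrow> complex ^ 'n \<Rightarrow> ('g \<Rightarrow> 'n cpoly \<Rightarrow> 'n cpoly)
   \<Rightarrow> 'g \<Rightarrow> ('n cpoly \<Rightarrow> 'n cpoly) set \<Rightarrow> ('n cpoly \<Rightarrow> 'n cpoly) set"
  where "isotropy_action \<F> p \<rho>' x A =
    (\<Union>D\<in>A. isotropy_kernel \<F> p +>\<^bsub>vector_fields\<^esub> lie_bracket vector_fields (\<rho>' x) D)"

definition eta_at ::
  "('n::finite cpoly \<Rightarrow> 'n cpoly) set \<Rightarrow> complex ^ 'n \<Rightarrow> (complex, 'g, 'm) lie_struct_scheme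
   \<Rightarrow> ('g \<Rightarrow> 'n cpoly \<Rightarrow> 'n cpoly) \<Rightarrow> 'g \<Rightarrow> 'g \<Rightarrow> ('n cpoly \<Rightarrow> 'n cpoly) set"
  where "eta_at \<F> p L \<rho>' =
    (\<lambda>x\<in>carrier L. \<lambda>y\<in>carrier L.
       isotropy_kernel \<F> p +>\<^bsub>vector_fields\<^esub>
         (\<rho>' (lie_bracket L x y) \<ominus>\<^bsub>vector_fields\<^esub> lie_bracket vector_fields (\<rho>' x) (\<rho>' y)))"

definition isotropy_H2 ::
  "('n::finite cpoly \<Rightarrow> 'n cpoly) set \<Rightarrow> complex ^ 'n \<Rightarrow> (complex, 'g, 'm) lie_struct_scheme
   \<Rightarrow> ('g \<Rightarrow> 'n cpoly \<Rightarrow> 'n cpoly)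
   \<Rightarrow> (complex, ('g \<Rightarrow> 'g \<Rightarrow> ('n cpoly \<Rightarrow> 'n cpoly) set) set) module"
  where "isotropy_H2 \<F> p L \<rho>' = ce_H2 CC L (isotropy \<F> p) (isotropy_action \<F> p \<rho>')"

text \<open>Computed from a linear extension \<open>\<rho>'\<close>; as an element of \<open>isotropy_H2\<close> it is independent of this
  choice when \<open>p\<close> is a strongly singular fixed point.\<close>

definition obstruction_class ::
  "('n::finite cpoly \<Rightarrow> 'n cpoly) set \<Rightarrow> complex ^ 'n \<Rightarrow> (complex, 'g, 'm) lie_struct_scheme
   \<Rightarrow> ('g \<Rightarrow> 'n cpoly \<Rightarrow> 'n cpoly) \<Rightarrow> ('g \<Rightarrow> 'g \<Rightarrow> ('n cpoly \<Rightarrow> 'n cpoly) set) set"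
  where "obstruction_class \<F> p L \<rho>' =
    ce_class2 CC L (isotropy \<F> p) (isotropy_action \<F> p \<rho>') (eta_at \<F> p L \<rho>')"

end

(* A derivation of the polynomial algebra is the sum of D(x_i) d/dx_i, so the foliation
   F = I_W X(C^d) consists exactly of the derivations mapping everything into I_W; hence a linear
   extension rho' of rho preserves F, and its curvature, inducing zero on O_W, lies in F.
   If sigma is an extension of rho by a Lie algebra morphism, then D = sigma - rho' takes values
   in F. As sigma is flat, the cocycle eta of rho' equals the coboundary of the class of D up to
   [D x, D y], and [F, F] is contained in I_p F at a strongly singular point p. That p is a fixed
   point makes I_p F invariant under rho', so that the action on F / I_p F is well defined. *)
theory Submission
  imports Defs
begin

section \<open>Quotient modules\<close>

text \<open>The two facts about \<open>I_p F\<close> are both Leibniz computations. If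
  \<open>V\<close> is tangent to \<open>W\<close> and vanishes at \<open>p\<close>, then [V, g Z] =
  V(g) Z + g [V, Z], where V(g) lies in \<open>I_p\<close> and [V, Z] lies in \<open>F\<close>. For
  [F, F], the i-th coordinate of [D, E] is D(E x_i) - E(D x_i); a summand h Z of D contributes h
  Z(g) with g = E x_i in \<open>I_W\<close>. Strong singularity makes Z(g) vanish at
  \<open>p\<close>, so Z(g) serves as the factor from \<open>I_p\<close> while h d/dx_i is the
  factor from \<open>F\<close>. What shapes the argument is that \<open>F\<close> has a test on
  values, whereas \<open>I_p F\<close> is handled through its generators: membership there is shown
  by writing out products. The zero of the cohomology space is literally the set of coboundaries, so
  exhibiting a linear primitive of the cocycle settles the vanishing of its class.\<close>

text \<open>One setting for both quotients that occur: polynomials modulo \<open>I_W\<close>, and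
  \<open>F\<close> modulo \<open>I_p F\<close>.\<close>

locale quotient_module = module K M + submodule N K M
  for K :: "('k, 'c) ring_scheme" and M :: "('k, 'a, 'm) module_scheme" and N
begin

sublocale abelian_subgroup N M
  by (intro abelian_subgroupI3 additive_subgroupI subgroup_axioms M.abelian_group_axioms)

lemma carrier_quot_module: "carrier (quot_module M N) = (\<lambda>a. N +>\<^bsub>M\<^esub> a) ` carrier M"
  by (auto simp: quot_module_def FactRing_def A_RCOSETS_def')

lemma coset_closed [intro]: "a \<in> carrier M \<Longrightarrow> N +>\<^bsub>M\<^esub> a \<in> carrier (quot_module M N)"
  by (simp add: carrier_quot_module)

lemma coset_add:
  "\<lbrakk>a \<in> carrier M; b \<in> carrier M\<rbrakk>
    \<Longrightarrow> (N +>\<^bsub>M\<^esub> a) \<oplus>\<^bsub>quot_module M N\<^esub> (N +>\<^bsub>M\<^esub> b) = N +>\<^bsub>M\<^esub> (a \<oplus>\<^bsub>M\<^esub> b)"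
  by (simp add: quot_module_def FactRing_def a_rcos_sum)

lemma zero_quot_module: "\<zero>\<^bsub>quot_module M N\<^esub> = N +>\<^bsub>M\<^esub> \<zero>\<^bsub>M\<^esub>"
  by (simp add: quot_module_def FactRing_def a_subset)

lemma coset_eq_iff:
  assumes "a \<in> carrier M" "b \<in> carrier M"
  shows "N +>\<^bsub>M\<^esub> a = N +>\<^bsub>M\<^esub> b \<longleftrightarrow> a \<ominus>\<^bsub>M\<^esub> b \<in> N"
proof -
  have "a \<ominus>\<^bsub>M\<^esub> b \<in> N \<longleftrightarrow> a \<in> N +>\<^bsub>M\<^esub> b"
    using assms by (simp add: a_rcos_module M.minus_eq)
  also have "\<dots> \<longleftrightarrow> N +>\<^bsub>M\<^esub> a = N +>\<^bsub>M\<^esub> b"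
    using assms a_rcos_self a_repr_independence' by blast
  finally show ?thesis by simp
qed

text \<open>Scalar multiplication on the quotient is a union of cosets over all representatives. Two
  representatives differ by an element of \<open>N\<close>, and \<open>N\<close> is stable under
  scalars, so all these cosets coincide and the union collapses.\<close>

lemma coset_smult:
  assumes "c \<in> carrier K" "a \<in> carrier M"
  shows "c \<odot>\<^bsub>quot_module M N\<^esub> (N +>\<^bsub>M\<^esub> a) = N +>\<^bsub>M\<^esub> (c \<odot>\<^bsub>M\<^esub> a)"
proof -
  have "N +>\<^bsub>M\<^esub> (c \<odot>\<^bsub>M\<^esub> b) = N +>\<^bsub>M\<^esub> (c \<odot>\<^bsub>M\<^esub> a)" if b: "b \<in> N +>\<^bsub>M\<^esub> a" for b
  proof -
    have bM: "b \<in> carrier M" using b assms(2) a_elemrcos_carrier by blast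
    have "c \<odot>\<^bsub>M\<^esub> b \<ominus>\<^bsub>M\<^esub> c \<odot>\<^bsub>M\<^esub> a = c \<odot>\<^bsub>M\<^esub> (b \<ominus>\<^bsub>M\<^esub> a)"
      using assms bM by (simp add: M.minus_eq smult_r_distr smult_r_minus)
    moreover have "b \<ominus>\<^bsub>M\<^esub> a \<in> N"
      using b assms(2) bM by (simp add: a_rcos_module M.minus_eq)
    ultimately show ?thesis
      using assms bM by (simp add: coset_eq_iff)
  qed
  moreover have "a \<in> N +>\<^bsub>M\<^esub> a" using assms(2) by (rule a_rcos_self)
  ultimately have "(\<Union>b\<in>N +>\<^bsub>M\<^esub> a. N +>\<^bsub>M\<^esub> (c \<odot>\<^bsub>M\<^esub> b)) = N +>\<^bsub>M\<^esub> (c \<odot>\<^bsub>M\<^esub> a)"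
    by (intro SUP_eq_const) blast+
  then show ?thesis by (simp add: quot_module_def)
qed

lemma module_quot_module: "module K (quot_module M N)"
proof (rule moduleI)
  show "cring K" by (rule R.cring_axioms)
  show "abelian_group (quot_module M N)"
  proof (rule abelian_groupI)
    show "\<exists>B\<in>carrier (quot_module M N). B \<oplus>\<^bsub>quot_module M N\<^esub> A = \<zero>\<^bsub>quot_module M N\<^esub>"
      if A: "A \<in> carrier (quot_module M N)" for A
    proof -
      obtain a where "a \<in> carrier M" "A = N +>\<^bsub>M\<^esub> a" using A by (auto simp: carrier_quot_module)
      then show ?thesis
        by (intro bexI[of _ "N +>\<^bsub>M\<^esub> (\<ominus>\<^bsub>M\<^esub> a)"])
          (auto simp: coset_add zero_quot_module M.l_neg)
    qed
  qed (auto simp: carrier_quot_module coset_add zero_quot_module M.a_ac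
      simp del: a_coset_add_zero)
qed (auto simp: carrier_quot_module coset_add coset_smult smult_l_distr smult_r_distr smult_assoc1)

lemma coset_minus:
  assumes "a \<in> carrier M" "b \<in> carrier M"
  shows "(N +>\<^bsub>M\<^esub> a) \<ominus>\<^bsub>quot_module M N\<^esub> (N +>\<^bsub>M\<^esub> b) = N +>\<^bsub>M\<^esub> (a \<ominus>\<^bsub>M\<^esub> b)"
proof -
  interpret Q: module K "quot_module M N" by (rule module_quot_module)
  have "\<ominus>\<^bsub>quot_module M N\<^esub> (N +>\<^bsub>M\<^esub> b) = N +>\<^bsub>M\<^esub> (\<ominus>\<^bsub>M\<^esub> b)"
    using assms(2)
    by (intro Q.minus_equality) (auto simp: coset_add zero_quot_module M.l_neg simp del: a_coset_add_zero)
  then show ?thesis using assms by (simp add: a_minus_def coset_add)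
qed

end

section \<open>Coboundaries\<close>

lemma linear_mapsD:
  assumes "\<phi> \<in> linear_maps K V U"
  shows "v \<in> carrier V \<Longrightarrow> \<phi> v \<in> carrier U"
    and "\<lbrakk>v \<in> carrier V; w \<in> carrier V\<rbrakk> \<Longrightarrow> \<phi> (v \<oplus>\<^bsub>V\<^esub> w) = \<phi> v \<oplus>\<^bsub>U\<^esub> \<phi> w"
    and "\<lbrakk>c \<in> carrier K; v \<in> carrier V\<rbrakk> \<Longrightarrow> \<phi> (c \<odot>\<^bsub>V\<^esub> v) = c \<odot>\<^bsub>U\<^esub> \<phi> v"
  using assms by (auto simp: linear_maps_def)

lemma linear_maps_minus:
  assumes "module K V" "module K U"
    and \<phi>: "\<phi> \<in> linear_maps K V U" and \<psi>: "\<psi> \<in> linear_maps K V U"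
  shows "(\<lambda>v. \<phi> v \<ominus>\<^bsub>U\<^esub> \<psi> v) \<in> linear_maps K V U"
proof -
  interpret V: module K V by fact
  interpret U: module K U by fact
  show ?thesis
    using linear_mapsD[OF \<phi>] linear_mapsD[OF \<psi>]
    by (auto simp: linear_maps_def U.minus_eq U.smult_r_distr U.smult_r_minus U.minus_add U.a_ac)
qed

lemma linear_maps_add:
  assumes "module K V" "module K U"
    and \<phi>: "\<phi> \<in> linear_maps K V U" and \<psi>: "\<psi> \<in> linear_maps K V U"
  shows "(\<lambda>v. \<phi> v \<oplus>\<^bsub>U\<^esub> \<psi> v) \<in> linear_maps K V U"
proof -
  interpret V: module K V by fact
  interpret U: module K U by fact
  show ?thesis
    using linear_mapsD[OF \<phi>] linear_mapsD[OF \<psi>]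
    by (auto simp: linear_maps_def U.smult_r_distr U.a_ac)
qed

text \<open>The decomposition of \<open>\<delta>\<close> is assumed on the carrier only, because it
  is later applied to \<gamma> = (\<gamma> - \<beta>) + \<beta>, an identity that relies on values
  in the module \<open>M\<close>.\<close>

lemma ce_d1_add:
  assumes L: "lie_algebra K L" and M: "module K M"
    and act: "\<And>x. x \<in> carrier L \<Longrightarrow> act x \<in> linear_maps K M M"
    and \<beta>: "\<beta> \<in> linear_maps K L M" and \<gamma>: "\<gamma> \<in> linear_maps K L M"
    and \<delta>: "\<And>x. x \<in> carrier L \<Longrightarrow> \<delta> x = \<beta> x \<oplus>\<^bsub>M\<^esub> \<gamma> x"
  shows "ce_d1 L M act \<delta> = ce_d1 L M act \<beta> \<oplus>\<^bsub>ce_cochains2 K L M\<^esub> ce_d1 L M act \<gamma>"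
proof -
  interpret L: lie_algebra K L by fact
  interpret M: module K M by fact
  note closed = linear_mapsD(1)[OF \<beta>] linear_mapsD(1)[OF \<gamma>]
  have "act x (\<delta> y) \<ominus>\<^bsub>M\<^esub> act y (\<delta> x) \<ominus>\<^bsub>M\<^esub> \<delta> (lie_bracket L x y) =
      (act x (\<beta> y) \<ominus>\<^bsub>M\<^esub> act y (\<beta> x) \<ominus>\<^bsub>M\<^esub> \<beta> (lie_bracket L x y)) \<oplus>\<^bsub>M\<^esub>
      (act x (\<gamma> y) \<ominus>\<^bsub>M\<^esub> act y (\<gamma> x) \<ominus>\<^bsub>M\<^esub> \<gamma> (lie_bracket L x y))"
    if "x \<in> carrier L" "y \<in> carrier L" for x y
    using that
    by (simp add: \<delta> closed L.bracket_closed linear_mapsD[OF act] M.minus_eq M.minus_add M.a_ac)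
  then show ?thesis
    by (auto simp: ce_d1_def ce_cochains2_def fun_eq_iff restrict_def)
qed

text \<open>Translating by a coboundary permutes the coboundaries: d \<gamma> + d \<beta> =
  d(\<gamma> + \<beta>), and conversely d \<gamma> = d(\<gamma> - \<beta>) + d \<beta>.\<close>

lemma ce_class2_coboundary:
  assumes L: "lie_algebra K L" and M: "module K M"
    and act: "\<And>x. x \<in> carrier L \<Longrightarrow> act x \<in> linear_maps K M M"
    and \<beta>: "\<beta> \<in> linear_maps K L M"
  shows "ce_class2 K L M act (ce_d1 L M act \<beta>) = ce_coboundaries2 K L M act"
proof -
  interpret L: lie_algebra K L by fact
  interpret M: module K M by fact
  note add = ce_d1_add[OF L M act]
  show ?thesis
  proof (intro equalityI subsetI)
    fix \<omega> assume "\<omega> \<in> ce_class2 K L M act (ce_d1 L M act \<beta>)"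
    then obtain \<gamma> where \<gamma>: "\<gamma> \<in> linear_maps K L M"
      "\<omega> = ce_d1 L M act \<gamma> \<oplus>\<^bsub>ce_cochains2 K L M\<^esub> ce_d1 L M act \<beta>"
      by (auto simp: ce_class2_def ce_coboundaries2_def a_r_coset_def')
    then have "\<omega> = ce_d1 L M act (\<lambda>x. \<gamma> x \<oplus>\<^bsub>M\<^esub> \<beta> x)"
      using add[OF _ \<gamma>(1) \<beta>] by simp
    then show "\<omega> \<in> ce_coboundaries2 K L M act"
      unfolding ce_coboundaries2_def
      using linear_maps_add[OF L.module_axioms M \<gamma>(1) \<beta>] by blast
  next
    fix \<omega> assume "\<omega> \<in> ce_coboundaries2 K L M act"
    then obtain \<gamma> where \<gamma>: "\<gamma> \<in> linear_maps K L M" "\<omega> = ce_d1 L M act \<gamma>"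
      by (auto simp: ce_coboundaries2_def)
    let ?\<delta> = "\<lambda>x. \<gamma> x \<ominus>\<^bsub>M\<^esub> \<beta> x"
    have \<delta>: "?\<delta> \<in> linear_maps K L M" by (rule linear_maps_minus[OF L.module_axioms M \<gamma>(1) \<beta>])
    have "\<omega> = ce_d1 L M act ?\<delta> \<oplus>\<^bsub>ce_cochains2 K L M\<^esub> ce_d1 L M act \<beta>"
      unfolding \<gamma>(2) using linear_mapsD(1)[OF \<gamma>(1)] linear_mapsD(1)[OF \<beta>]
      by (intro add \<delta> \<beta>) (auto simp: M.minus_eq M.a_assoc M.l_neg)
    then show "\<omega> \<in> ce_class2 K L M act (ce_d1 L M act \<beta>)"
      using \<delta> by (auto simp: ce_class2_def ce_coboundaries2_def a_r_coset_def')
  qed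
qed

text \<open>\<open>FactRing\<close> takes the subgroup itself as its zero, so the vanishing of a
  class is an equality of sets of cochains.\<close>

lemma zero_ce_H2: "\<zero>\<^bsub>ce_H2 K L M act\<^esub> = ce_coboundaries2 K L M act"
  by (simp add: ce_H2_def quot_module_def FactRing_def)

section \<open>Polynomials\<close>

abbreviation const_poly :: "complex \<Rightarrow> 'n cpoly"
  where "const_poly \<equiv> Poly_Mapping.single 0"

definition var_poly :: "'n \<Rightarrow> 'n cpoly"
  where "var_poly i = Poly_Mapping.single (Poly_Mapping.single i 1) 1"

text \<open>Serves on two levels: for polynomials as sums of monomials, and for exponent vectors,
  which are finitely supported functions themselves.\<close>

lemma poly_mapping_add_induct [case_names zero single add]:
  fixes f :: "'a \<Rightarrow>\<^sub>0 'b::comm_monoid_add"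
  assumes "P 0"
    and "\<And>k v. P (Poly_Mapping.single k v)"
    and "\<And>f g. P f \<Longrightarrow> P g \<Longrightarrow> P (f + g)"
  shows "P f"
proof (induction f rule: Poly_Mapping.update_induct)
  case const
  then show ?case using assms(1) by simp
next
  case (update f a b)
  \<comment> \<open>\<open>a\<close> lies outside the support of \<open>f\<close>, so overwriting
    the coefficient there amounts to adding a monomial.\<close>
  have "Poly_Mapping.update a b f = Poly_Mapping.single a b + f"
    using update.hyps
    by (intro poly_mapping_eqI) (auto simp: lookup_update lookup_add lookup_single in_keys_iff)
  then show ?case using assms update.IH by simp
qed

text \<open>The constants and the variables generate the polynomial ring. This form suits
  derivations, since additivity and the Leibniz rule carry a property through \<open>add\<close> and
  \<open>mult\<close>.\<close>

lemma poly_induct [case_names const var add mult]: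
  fixes f :: "'n cpoly"
  assumes const: "\<And>c. P (const_poly c)"
    and var: "\<And>i. P (var_poly i)"
    and add: "\<And>f g. P f \<Longrightarrow> P g \<Longrightarrow> P (f + g)"
    and mult: "\<And>f g. P f \<Longrightarrow> P g \<Longrightarrow> P (f * g)"
  shows "P f"
proof -
  have power_var: "P (Poly_Mapping.single (Poly_Mapping.single i k) 1)" for i k
  proof (induction k)
    case 0
    then show ?case using const[of 1] by simp
  next
    case (Suc k)
    have "Poly_Mapping.single (Poly_Mapping.single i (Suc k)) (1::complex) =
      var_poly i * Poly_Mapping.single (Poly_Mapping.single i k) 1"
      by (simp add: var_poly_def mult_single flip: single_add)
    then show ?case using var mult Suc by simp
  qed
  have monomial: "P (Poly_Mapping.single m 1)" for m
  proof (induction m rule: poly_mapping_add_induct)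
    case zero
    then show ?case by (rule const)
  next
    case (single i k)
    then show ?case by (rule power_var)
  next
    case (add m m')
    then show ?case using mult[OF add] by (simp add: mult_single)
  qed
  show ?thesis
  proof (induction f rule: poly_mapping_add_induct)
    case zero
    then show ?case using const[of 0] by simp
  next
    case (single m c)
    have "Poly_Mapping.single m c = const_poly c * Poly_Mapping.single m 1"
      by (simp add: mult_single)
    then show ?case using const mult monomial by simp
  next
    case (add f g)
    then show ?case by (rule assms(3))
  qed
qed

lemma poly_eval_zero [simp]: "poly_eval 0 p = 0"
  by (simp add: poly_eval_def)

lemma poly_eval_add [simp]: "poly_eval (f + g) p = poly_eval f p + poly_eval g p"
  unfolding poly_eval_def
  by (rule setsum_keys_plus_distrib) (auto simp: algebra_simps)

lemma poly_eval_single [simp]: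
  "poly_eval (Poly_Mapping.single m c) p =
    c * (\<Prod>i\<in>UNIV. (p $ i) ^ Poly_Mapping.lookup m i)"
  by (simp add: poly_eval_def)

lemma poly_eval_mult [simp]: "poly_eval (f * g) p = poly_eval f p * poly_eval g p"
proof (induction f rule: poly_mapping_add_induct)
  case zero
  then show ?case by simp
next
  case (single m c)
  show ?case
  proof (induction g rule: poly_mapping_add_induct)
    case zero
    then show ?case by simp
  next
    case (single m' c')
    then show ?case
      by (simp add: mult_single lookup_add power_add prod.distrib)
  next
    case (add f g)
    then show ?case by (simp add: distrib_left)
  qed
next
  case (add f g)
  then show ?case by (simp add: distrib_right)
qed

lemma poly_eval_uminus [simp]: "poly_eval (- f) p = - poly_eval f p"
  using poly_eval_add[of f "- f" p] by (simp add: eq_neg_iff_add_eq_0 add.commute)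

lemma poly_eval_diff [simp]: "poly_eval (f - g) p = poly_eval f p - poly_eval g p"
  using poly_eval_add[of f "- g" p] by simp

lemma poly_eval_var [simp]: "poly_eval (var_poly i) p = p $ i"
proof -
  have "(\<Prod>j\<in>UNIV. (p $ j) ^ Poly_Mapping.lookup (Poly_Mapping.single i (1::nat)) j) =
    (\<Prod>j\<in>UNIV. if j = i then p $ i else 1)"
    by (rule prod.cong) (auto simp: lookup_single when_def)
  then show ?thesis by (simp add: var_poly_def)
qed

text \<open>Stated for an arbitrary set of points, so that \<open>I_W\<close> and
  \<open>I_p\<close>, encoded as \<open>vanishing_ideal {p}\<close>, share these rules.\<close>

lemma vanishing_ideal_closed [simp]:
  "0 \<in> vanishing_ideal W"
  "f \<in> vanishing_ideal W \<Longrightarrow> g \<in> vanishing_ideal W \<Longrightarrow> f + g \<in> vanishing_ideal W"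
  "f \<in> vanishing_ideal W \<Longrightarrow> g \<in> vanishing_ideal W \<Longrightarrow> f - g \<in> vanishing_ideal W"
  "f \<in> vanishing_ideal W \<Longrightarrow> - f \<in> vanishing_ideal W"
  "f \<in> vanishing_ideal W \<Longrightarrow> f * g \<in> vanishing_ideal W"
  "f \<in> vanishing_ideal W \<Longrightarrow> g * f \<in> vanishing_ideal W"
  by (simp_all add: vanishing_ideal_def)

section \<open>Derivations of the polynomial algebra\<close>

lemma poly_algebra_simps [simp]:
  "carrier poly_algebra = UNIV" "monoid.mult poly_algebra = (*)" "one poly_algebra = 1"
  "zero poly_algebra = 0" "add poly_algebra = (+)"
  "module.smult poly_algebra = (\<lambda>c f. const_poly c * f)"
  by (simp_all add: poly_algebra_def)

lemma CC_simps [simp]: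
  "carrier CC = UNIV" "monoid.mult CC = (*)" "one CC = 1" "zero CC = 0" "add CC = (+)"
  by (simp_all add: ring_of_type_algebra_def fun_eq_iff)

lemma Der_simps [simp]:
  "carrier (Der K A) = derivations K A"
  "zero (Der K A) = (\<lambda>a\<in>carrier A. \<zero>\<^bsub>A\<^esub>)"
  "add (Der K A) = (\<lambda>D E. \<lambda>a\<in>carrier A. D a \<oplus>\<^bsub>A\<^esub> E a)"
  "module.smult (Der K A) = (\<lambda>c D. \<lambda>a\<in>carrier A. c \<odot>\<^bsub>A\<^esub> D a)"
  "lie_bracket (Der K A) = (\<lambda>D E. \<lambda>a\<in>carrier A. D (E a) \<ominus>\<^bsub>A\<^esub> E (D a))"
  by (simp_all add: Der_def)

lemma abelian_group_poly_algebra: "abelian_group (poly_algebra :: (complex, 'n::finite cpoly) module)"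
  by (rule abelian_groupI) (auto simp: algebra_simps intro: exI[of _ "- x" for x])

lemma poly_algebra_minus [simp]: "f \<ominus>\<^bsub>poly_algebra\<^esub> g = f - g"
proof -
  interpret abelian_group "poly_algebra :: (complex, 'n::finite cpoly) module"
    by (rule abelian_group_poly_algebra)
  have "\<ominus>\<^bsub>poly_algebra\<^esub> g = - g"
    by (rule minus_equality) auto
  then show ?thesis by (simp add: a_minus_def)
qed

lemma derivation_iff:
  "D \<in> derivations CC poly_algebra \<longleftrightarrow>
    (\<forall>f g. D (f + g) = D f + D g) \<and> (\<forall>c f. D (const_poly c * f) = const_poly c * D f) \<and>
    (\<forall>f g. D (f * g) = D f * g + f * D g)"
  by (auto simp: derivations_def linear_maps_def)

lemma derivationD:
  assumes "D \<in> derivations CC poly_algebra"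
  shows "D (f + g) = D f + D g" "D (const_poly c * f) = const_poly c * D f"
    "D (f * g) = D f * g + f * D g" "D 0 = 0" "D (- f) = - D f" "D (f - g) = D f - D g"
    "D (const_poly c) = 0"
proof -
  show add: "D (f + g) = D f + D g" for f g using assms by (blast dest: derivation_iff[THEN iffD1])
  show smult: "D (const_poly c * f) = const_poly c * D f" for c f
    using assms by (blast dest: derivation_iff[THEN iffD1])
  show mult: "D (f * g) = D f * g + f * D g" for f g using assms by (blast dest: derivation_iff[THEN iffD1])
  show zero: "D 0 = 0" using add[of 0 0] by simp
  show minus: "D (- f) = - D f" for f
    using add[of f "- f"] zero by (simp add: eq_neg_iff_add_eq_0 add.commute)
  show "D (f - g) = D f - D g" using add[of f "- g"] minus by simp
  have "D 1 = 0" using mult[of 1 1] by simp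
  then show "D (const_poly c) = 0" using smult[of c 1] by simp
qed

lemma derivation_eqI:
  assumes D: "D \<in> derivations CC poly_algebra" and E: "E \<in> derivations CC poly_algebra"
    and var: "\<And>i. D (var_poly i) = E (var_poly i)"
  shows "D = E"
proof
  fix f show "D f = E f"
    by (induction f rule: poly_induct) (simp_all add: var derivationD[OF D] derivationD[OF E])
qed

lemma derivations_closed:
  assumes D: "D \<in> derivations CC poly_algebra" and E: "E \<in> derivations CC poly_algebra"
  shows "(\<lambda>f. D f + E f) \<in> derivations CC poly_algebra"
    and "(\<lambda>f. D f - E f) \<in> derivations CC poly_algebra"
    and "(\<lambda>f. D (E f) - E (D f)) \<in> derivations CC poly_algebra"
  unfolding derivation_iff by (simp_all add: derivationD[OF D] derivationD[OF E] algebra_simps)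

lemma derivation_mult:
  assumes D: "D \<in> derivations CC poly_algebra"
  shows "(\<lambda>f. g * D f) \<in> derivations CC poly_algebra"
  unfolding derivation_iff by (simp add: derivationD[OF D] algebra_simps)

lemma derivation_zero: "(\<lambda>f. 0) \<in> derivations CC poly_algebra"
  by (simp add: derivation_iff)

lemma derivations_sum:
  assumes "\<And>i. i \<in> S \<Longrightarrow> D i \<in> derivations CC poly_algebra"
  shows "(\<lambda>f. \<Sum>i\<in>S. D i f) \<in> derivations CC poly_algebra"
  using assms
  by (induction S rule: infinite_finite_induct) (simp_all add: derivations_closed derivation_zero)

section \<open>Formal partial derivatives as a basis of the vector fields\<close>

text \<open>Subtraction of exponents is truncated: if x_i does not occur in \<open>m\<close>, the
  exponent stays \<open>m\<close>, but the factor \<open>of_nat 0\<close> removes the term.\<close>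

definition partial :: "'n \<Rightarrow> 'n::finite cpoly \<Rightarrow> 'n cpoly"
  where "partial i f = (\<Sum>m\<in>Poly_Mapping.keys f.
    Poly_Mapping.single (m - Poly_Mapping.single i 1)
      (of_nat (Poly_Mapping.lookup m i) * Poly_Mapping.lookup f m))"

lemma partial_zero [simp]: "partial i 0 = 0"
  by (simp add: partial_def)

lemma partial_add: "partial i (f + g) = partial i f + partial i g"
  unfolding partial_def
  by (rule setsum_keys_plus_distrib) (auto simp: algebra_simps simp flip: single_add)

lemma partial_single:
  "partial i (Poly_Mapping.single m c) =
    Poly_Mapping.single (m - Poly_Mapping.single i 1) (of_nat (Poly_Mapping.lookup m i) * c)"
  by (simp add: partial_def)

text \<open>The exponents agree when x_i occurs in \<open>m\<close>, because then nothing is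
  truncated; otherwise both coefficients are zero. This is the Leibniz rule at the level of
  exponents.\<close>

lemma single_of_nat_diff_add:
  "Poly_Mapping.single (m - Poly_Mapping.single i 1 + m')
      (of_nat (Poly_Mapping.lookup m i) * c :: complex) =
    Poly_Mapping.single (m + m' - Poly_Mapping.single i 1) (of_nat (Poly_Mapping.lookup m i) * c)"
proof (cases "Poly_Mapping.lookup m i = 0")
  case False
  have "m - Poly_Mapping.single i 1 + m' = m + m' - Poly_Mapping.single i 1"
    using False
    by (intro poly_mapping_eqI) (auto simp: lookup_minus lookup_add lookup_single when_def)
  then show ?thesis by simp
qed simp

lemma partial_mult: "partial i (f * g) = partial i f * g + f * partial i g"
proof (induction f rule: poly_mapping_add_induct)
  case zero
  then show ?case by simp
next
  case (single m c)
  show ?case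
  proof (induction g rule: poly_mapping_add_induct)
    case zero
    then show ?case by simp
  next
    case (single m' c')
    show ?case
      \<comment> \<open>The two instances bring both Leibniz terms to the common exponent m + m' -
        e_i, where the coefficients add up.\<close>
      using single_of_nat_diff_add[of m i m' "c * c'"] single_of_nat_diff_add[of m' i m "c * c'"]
      by (simp add: mult_single partial_single lookup_add single_add algebra_simps)
  next
    case (add f g)
    then show ?case by (simp add: partial_add algebra_simps)
  qed
next
  case (add f g)
  then show ?case by (simp add: partial_add algebra_simps)
qed

lemma partial_derivation: "partial i \<in> derivations CC poly_algebra"
  by (simp add: derivation_iff partial_add partial_mult partial_single)

lemma partial_var: "partial i (var_poly j) = (if i = j then 1 else 0)"
  by (auto simp: var_poly_def partial_single lookup_single)

text \<open>Both sides are derivations, and \<open>partial i (var_poly j)\<close> is the Kronecker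
  delta, so they agree on the variables. It turns information about the values on variables into an
  explicit sum of generators.\<close>

lemma derivation_eq_sum_partial:
  assumes "D \<in> derivations CC poly_algebra"
  shows "D = (\<lambda>f. \<Sum>i\<in>UNIV. D (var_poly i) * partial i f)"
proof (rule derivation_eqI)
  show "(\<lambda>f. \<Sum>i\<in>UNIV. D (var_poly i) * partial i f) \<in> derivations CC poly_algebra"
    by (intro derivations_sum derivation_mult partial_derivation)
qed (use assms in \<open>simp_all add: partial_var if_distrib cong: if_cong\<close>)

text \<open>Bridge between the analytic definition of strong singularity and algebraic derivations:
  D f at \<open>p\<close> is the differential of f applied to the tangent vector with coordinates
  D(x_i) at \<open>p\<close>. Existence and value go through one induction, since the sum and
  product rules yield both.\<close>

lemma poly_eval_has_derivative:
  fixes D :: "'n::finite cpoly \<Rightarrow> 'n cpoly"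
  assumes D: "D \<in> derivations CC poly_algebra"
  shows "\<exists>f'. (poly_eval f has_derivative f') (at p) \<and>
    f' (\<chi> i. poly_eval (D (var_poly i)) p) = poly_eval (D f) p"
proof (induction f rule: poly_induct)
  case (const c)
  have "poly_eval (const_poly c) = (\<lambda>_. c)" by auto
  then show ?case by (intro exI[of _ "\<lambda>_. 0"]) (simp add: derivationD[OF D])
next
  case (var i)
  have "poly_eval (var_poly i) = (\<lambda>p. p $ i)" by auto
  then show ?case
    using bounded_linear.has_derivative[OF bounded_linear_vec_nth[of i] has_derivative_ident]
    by (intro exI[of _ "\<lambda>h :: complex ^ 'n. h $ i"]) simp
next
  case (add f g)
  then obtain f' g' where *: "(poly_eval f has_derivative f') (at p)"
    "f' (\<chi> i. poly_eval (D (var_poly i)) p) = poly_eval (D f) p"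
    "(poly_eval g has_derivative g') (at p)"
    "g' (\<chi> i. poly_eval (D (var_poly i)) p) = poly_eval (D g) p"
    by blast
  have "poly_eval (f + g) = (\<lambda>p. poly_eval f p + poly_eval g p)" by auto
  then show ?case using has_derivative_add[OF *(1,3)] *
    by (intro exI[of _ "\<lambda>h. f' h + g' h"]) (simp add: derivationD[OF D])
next
  case (mult f g)
  then obtain f' g' where *: "(poly_eval f has_derivative f') (at p)"
    "f' (\<chi> i. poly_eval (D (var_poly i)) p) = poly_eval (D f) p"
    "(poly_eval g has_derivative g') (at p)"
    "g' (\<chi> i. poly_eval (D (var_poly i)) p) = poly_eval (D g) p"
    by blast
  have "poly_eval (f * g) = (\<lambda>p. poly_eval f p * poly_eval g p)" by auto
  then show ?case using has_derivative_mult[OF *(1,3)] *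
    by (intro exI[of _ "\<lambda>h. poly_eval f p * g' h + f' h * poly_eval g p"])
      (auto simp: derivationD[OF D] algebra_simps)
qed

lemma strongly_singular_derivation:
  assumes "strongly_singular W p" and "f \<in> vanishing_ideal W"
    and "D \<in> derivations CC poly_algebra"
  shows "poly_eval (D f) p = 0"
proof -
  obtain f' where f': "(poly_eval f has_derivative f') (at p)"
    "f' (\<chi> i. poly_eval (D (var_poly i)) p) = poly_eval (D f) p"
    using poly_eval_has_derivative[OF assms(3)] by blast
  have "(poly_eval f has_derivative (\<lambda>_. 0)) (at p)"
    using assms(1,2) by (simp add: strongly_singular_def)
  \<comment> \<open>Frechet derivatives are unique, so the differential found above is the zero map
    supplied by strong singularity.\<close>
  then have "f' = (\<lambda>_. 0)" using f'(1) has_derivative_unique by blast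
  then show ?thesis using f'(2) by simp
qed

lemma module_vector_fields: "module CC (vector_fields :: (complex, 'n::finite cpoly \<Rightarrow> 'n cpoly) lie_struct)"
proof (rule moduleI)
  show "cring CC" by (rule cring_from_type_algebra)
  show "abelian_group (vector_fields :: (complex, 'n cpoly \<Rightarrow> 'n cpoly) lie_struct)"
  proof (rule abelian_groupI)
    fix D :: "'n cpoly \<Rightarrow> 'n cpoly"
    assume "D \<in> carrier vector_fields"
    then have "(\<lambda>f. 0 - D f) \<in> derivations CC poly_algebra"
      by (intro derivations_closed(2) derivation_zero) simp
    then show "\<exists>E\<in>carrier vector_fields. E \<oplus>\<^bsub>vector_fields\<^esub> D = \<zero>\<^bsub>vector_fields\<^esub>"
      by (intro bexI) (auto simp: fun_eq_iff)
  qed (auto simp: derivations_closed derivation_zero restrict_def fun_eq_iff)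
next
  fix c and D :: "'n cpoly \<Rightarrow> 'n cpoly"
  assume "D \<in> carrier vector_fields"
  then show "c \<odot>\<^bsub>vector_fields\<^esub> D \<in> carrier vector_fields"
    by (simp add: restrict_def derivation_mult)
qed (auto simp: fun_eq_iff single_add algebra_simps mult_single simp flip: mult.assoc)

lemma vector_fields_simps:
  "\<zero>\<^bsub>vector_fields\<^esub> = (\<lambda>f. 0)"
  "D \<oplus>\<^bsub>vector_fields\<^esub> E = (\<lambda>f. D f + E f)"
  "c \<odot>\<^bsub>vector_fields\<^esub> D = (\<lambda>f. const_poly c * D f)"
  "lie_bracket vector_fields D E = (\<lambda>f. D (E f) - E (D f))"
  by (auto simp: restrict_def)

lemma vector_fields_minus:
  assumes "E \<in> derivations CC poly_algebra"
  shows "D \<ominus>\<^bsub>vector_fields\<^esub> E = (\<lambda>f. D f - E f)"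
proof -
  interpret V: module CC "vector_fields :: (complex, 'n::finite cpoly \<Rightarrow> 'n cpoly) lie_struct"
    by (rule module_vector_fields)
  have "(\<lambda>f. 0 - E f) \<in> derivations CC poly_algebra"
    using assms by (intro derivations_closed(2) derivation_zero)
  then have "\<ominus>\<^bsub>vector_fields\<^esub> E = (\<lambda>f. 0 - E f)"
    using assms by (intro V.minus_equality) (auto simp: fun_eq_iff)
  then show ?thesis by (simp add: a_minus_def fun_eq_iff)
qed

section \<open>Closure properties of the product of an ideal with a set of derivations\<close>

lemma ideal_der_prod_subset_derivations:
  assumes "N \<subseteq> derivations CC poly_algebra"
  shows "ideal_der_prod CC poly_algebra I N \<subseteq> derivations CC poly_algebra"
proof
  fix D assume "D \<in> ideal_der_prod CC poly_algebra I N"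
  then show "D \<in> derivations CC poly_algebra"
    by induction (use assms in \<open>auto simp: restrict_def derivations_closed derivation_mult\<close>)
qed

text \<open>The inductive set is generated by products and sums alone; a multiplier is absorbed by
  the ideal factor of each product. Constant multipliers give scalar multiples, and -1 gives
  differences.\<close>

lemma ideal_der_prod_mult:
  assumes "D \<in> ideal_der_prod CC poly_algebra (vanishing_ideal Z) N"
  shows "(\<lambda>f. g * D f) \<in> ideal_der_prod CC poly_algebra (vanishing_ideal Z) N"
  using assms
proof induction
  case (prod h D)
  have "(\<lambda>f\<in>carrier poly_algebra. (g * h) \<otimes>\<^bsub>poly_algebra\<^esub> D f)
      \<in> ideal_der_prod CC poly_algebra (vanishing_ideal Z) N"
    using prod by (intro ideal_der_prod.prod) auto
  then show ?case by (simp add: restrict_def mult.assoc)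
next
  case (sum D E)
  then show ?case
    using ideal_der_prod.sum[OF sum.IH] by (simp add: restrict_def distrib_left)
qed

lemma ideal_der_prodI:
  assumes "f \<in> vanishing_ideal Z" "D \<in> N"
  shows "(\<lambda>a. f * D a) \<in> ideal_der_prod CC poly_algebra (vanishing_ideal Z) N"
  using ideal_der_prod.prod[OF assms, of poly_algebra CC] by (simp add: restrict_def)

lemma ideal_der_prod_add:
  assumes "D \<in> ideal_der_prod CC poly_algebra I N" "E \<in> ideal_der_prod CC poly_algebra I N"
  shows "(\<lambda>a. D a + E a) \<in> ideal_der_prod CC poly_algebra I N"
  using ideal_der_prod.sum[OF assms] by (simp add: restrict_def)

lemma ideal_der_prod_zero:
  assumes "N \<noteq> {}"
  shows "(\<lambda>a. 0) \<in> ideal_der_prod CC poly_algebra (vanishing_ideal Z) N"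
  using assms ideal_der_prodI[of 0 Z _ N] by auto

lemma ideal_der_prod_diff:
  assumes "D \<in> ideal_der_prod CC poly_algebra (vanishing_ideal Z) N"
    and "E \<in> ideal_der_prod CC poly_algebra (vanishing_ideal Z) N"
  shows "(\<lambda>a. D a - E a) \<in> ideal_der_prod CC poly_algebra (vanishing_ideal Z) N"
  using ideal_der_prod_add[OF assms(1) ideal_der_prod_mult[OF assms(2), of "- 1"]] by simp

lemma ideal_der_prod_sum:
  assumes "N \<noteq> {}"
    and "\<And>i. i \<in> S \<Longrightarrow> D i \<in> ideal_der_prod CC poly_algebra (vanishing_ideal Z) N"
  shows "(\<lambda>a. \<Sum>i\<in>S. D i a) \<in> ideal_der_prod CC poly_algebra (vanishing_ideal Z) N"
  using assms(2)
  by (induction S rule: infinite_finite_induct)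
    (simp_all add: ideal_der_prod_zero[OF assms(1)] ideal_der_prod_add)

section \<open>The foliation of vector fields vanishing on the variety\<close>

text \<open>For the converse, the coefficients \<open>D (var_poly i)\<close> lie in
  \<open>I_W\<close>, which presents \<open>D\<close> as a finite sum of generators. From here on,
  closure properties of \<open>F\<close> reduce to those of the ideal.\<close>

lemma vanishing_foliation_iff:
  "D \<in> vanishing_foliation W \<longleftrightarrow>
    D \<in> derivations CC poly_algebra \<and> (\<forall>f. D f \<in> vanishing_ideal W)"
proof
  assume D: "D \<in> vanishing_foliation W"
  then have "D \<in> derivations CC poly_algebra"
    using ideal_der_prod_subset_derivations[of "carrier vector_fields"]
    by (auto simp: vanishing_foliation_def)
  moreover have "D f \<in> vanishing_ideal W" for f
    using D unfolding vanishing_foliation_def by induction auto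
  ultimately show "D \<in> derivations CC poly_algebra \<and> (\<forall>f. D f \<in> vanishing_ideal W)"
    by blast
next
  assume D: "D \<in> derivations CC poly_algebra \<and> (\<forall>f. D f \<in> vanishing_ideal W)"
  then have "(\<lambda>f. \<Sum>i\<in>UNIV. D (var_poly i) * partial i f) \<in> vanishing_foliation W"
    unfolding vanishing_foliation_def
    by (intro ideal_der_prod_sum ideal_der_prodI) (use partial_derivation in auto)
  then show "D \<in> vanishing_foliation W"
    using D by (simp only: derivation_eq_sum_partial[of D, symmetric])
qed

lemma vanishing_foliation_derivation:
  "D \<in> vanishing_foliation W \<Longrightarrow> D \<in> derivations CC poly_algebra"
  by (simp add: vanishing_foliation_iff)

lemma zero_vanishing_foliation: "(\<lambda>f. 0) \<in> vanishing_foliation W"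
  by (simp add: vanishing_foliation_iff derivation_zero)

text \<open>On values: \<open>V\<close> keeps D f inside \<open>I_W\<close>, and \<open>D\<close>
  sends everything into \<open>I_W\<close>.\<close>

lemma vanishing_foliation_bracket:
  assumes "V \<in> derivations CC poly_algebra" "V ` vanishing_ideal W \<subseteq> vanishing_ideal W"
    and "D \<in> vanishing_foliation W"
  shows "(\<lambda>f. V (D f) - D (V f)) \<in> vanishing_foliation W"
  using assms unfolding vanishing_foliation_iff
  by (intro conjI allI vanishing_ideal_closed(3) derivations_closed(3)) blast+

lemma quotient_module_coord_ring:
  "quotient_module CC (poly_algebra :: (complex, 'n::finite cpoly) module) (vanishing_ideal W)"
proof -
  have M: "module CC (poly_algebra :: (complex, 'n cpoly) module)"
    by (rule moduleI[OF cring_from_type_algebra abelian_group_poly_algebra])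
      (auto simp: single_add algebra_simps mult_single simp flip: mult.assoc)
  then interpret module CC "poly_algebra :: (complex, 'n cpoly) module" .
  have "\<ominus>\<^bsub>poly_algebra\<^esub> f = - f" for f :: "'n cpoly"
    using poly_algebra_minus[of 0 f] by (simp add: a_minus_def)
  then have "submodule (vanishing_ideal W) CC poly_algebra"
    by (intro submoduleI) auto
  then show ?thesis using M by (simp add: quotient_module_def)
qed

text \<open>Both \<open>\<rho>' [x, y]\<close> and \<open>[\<rho>' x, \<rho>' y]\<close> induce \<open>\<rho> [x, y]\<close> on the coordinate ring.\<close>

lemma curvature_in_vanishing_foliation:
  assumes L: "lie_algebra CC L" and \<rho>: "\<rho> \<in> lie_hom CC L (vector_fields_on W)"
    and \<rho>': "\<rho>' \<in> linear_maps CC L vector_fields" and ext: "extends W L \<rho> \<rho>'"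
    and x: "x \<in> carrier L" and y: "y \<in> carrier L"
  shows "(\<lambda>f. \<rho>' (lie_bracket L x y) f - (\<rho>' x (\<rho>' y f) - \<rho>' y (\<rho>' x f))) \<in> vanishing_foliation W"
proof -
  interpret quotient_module CC poly_algebra "vanishing_ideal W"
    by (rule quotient_module_coord_ring)
  let ?c = "\<lambda>f. vanishing_ideal W +>\<^bsub>poly_algebra\<^esub> f"
  have b: "lie_bracket L x y \<in> carrier L" using L x y by (rule lie_algebra.bracket_closed)
  have der: "\<rho>' z \<in> derivations CC poly_algebra" if "z \<in> carrier L" for z
    using linear_mapsD(1)[OF \<rho>' that] by simp
  have \<rho>_c: "\<rho> z (?c f) = ?c (\<rho>' z f)" if "z \<in> carrier L" for z f
    using ext that by (simp add: extends_def)
  have "\<rho>' (lie_bracket L x y) f - (\<rho>' x (\<rho>' y f) - \<rho>' y (\<rho>' x f)) \<in> vanishing_ideal W" for f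
  proof -
    \<comment> \<open>The bracket on the coordinate ring is an extensional function, so it can be
      evaluated only at an argument known to lie in the carrier.\<close>
    have c: "?c f \<in> carrier (coord_ring W)" unfolding coord_ring_def by (rule coset_closed) simp
    have "?c (\<rho>' (lie_bracket L x y) f) = \<rho> (lie_bracket L x y) (?c f)"
      using \<rho>_c[OF b] by simp
    also have "\<dots> = lie_bracket (vector_fields_on W) (\<rho> x) (\<rho> y) (?c f)"
      using \<rho> x y by (simp add: lie_hom_def del: Der_simps)
    also have "\<dots> = ?c (\<rho>' x (\<rho>' y f)) \<ominus>\<^bsub>coord_ring W\<^esub> ?c (\<rho>' y (\<rho>' x f))"
      using c x y by (simp add: \<rho>_c)
    also have "\<dots> = ?c (\<rho>' x (\<rho>' y f) - \<rho>' y (\<rho>' x f))"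
      unfolding coord_ring_def by (subst coset_minus) auto
    finally show ?thesis by (subst (asm) coset_eq_iff) auto
  qed
  then show ?thesis
    by (simp add: vanishing_foliation_iff derivations_closed der x y b)
qed

lemma extension_weak_symmetry_action:
  assumes "lie_algebra CC L" and "\<rho> \<in> lie_hom CC L (vector_fields_on W)"
    and \<rho>': "\<rho>' \<in> linear_maps CC L vector_fields" and ext: "extends W L \<rho> \<rho>'"
  shows "weak_symmetry_action L (vanishing_foliation W) \<rho>'"
proof -
  have der: "\<rho>' z \<in> derivations CC poly_algebra" if "z \<in> carrier L" for z
    using linear_mapsD(1)[OF \<rho>' that] by simp
  show ?thesis
    unfolding weak_symmetry_action_def
  proof (intro conjI ballI)
    fix x D assume "x \<in> carrier L" "D \<in> vanishing_foliation W"
    then show "lie_bracket vector_fields (\<rho>' x) D \<in> vanishing_foliation W"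
      unfolding vector_fields_simps using ext
      by (intro vanishing_foliation_bracket der) (auto simp: extends_def)
  next
    fix x y assume "x \<in> carrier L" "y \<in> carrier L"
    then show "\<rho>' (lie_bracket L x y) \<ominus>\<^bsub>vector_fields\<^esub> lie_bracket vector_fields (\<rho>' x) (\<rho>' y)
        \<in> vanishing_foliation W"
      using curvature_in_vanishing_foliation[OF assms]
      by (simp add: vector_fields_simps vector_fields_minus derivations_closed der del: Der_simps)
  qed (rule \<rho>')
qed

section \<open>The isotropy module\<close>

abbreviation foliation_module :: "(complex ^ 'n::finite) set \<Rightarrow> (complex, 'n cpoly \<Rightarrow> 'n cpoly) lie_struct"
  where "foliation_module W \<equiv> vector_fields\<lparr>carrier := vanishing_foliation W\<rparr>"

lemma module_foliation: "module CC (foliation_module W)"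
proof -
  interpret module CC "vector_fields :: (complex, 'a cpoly \<Rightarrow> 'a cpoly) lie_struct"
    by (rule module_vector_fields)
  have "\<ominus>\<^bsub>vector_fields\<^esub> D = (\<lambda>f. - D f)" if "D \<in> vanishing_foliation W" for D
    using vector_fields_minus[of D "\<lambda>f. 0"] vanishing_foliation_derivation[OF that]
    by (simp add: a_minus_def restrict_def)
  then have "submodule (vanishing_foliation W) CC vector_fields"
    by (intro submoduleI)
      (auto simp: vanishing_foliation_iff restrict_def derivations_closed derivation_mult
        derivation_zero derivations_closed(2)[OF derivation_zero, simplified])
  then show ?thesis by (rule submodule.submodule_is_module) (rule module_axioms)
qed

lemma foliation_module_minus:
  assumes "D \<in> vanishing_foliation W" "E \<in> vanishing_foliation W"
  shows "D \<ominus>\<^bsub>foliation_module W\<^esub> E = (\<lambda>f. D f - E f)"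
proof -
  interpret module CC "foliation_module W" by (rule module_foliation)
  have "(\<lambda>f. - E f) \<in> vanishing_foliation W"
    using assms(2) derivations_closed(2)[OF derivation_zero, of E]
    by (simp add: vanishing_foliation_iff)
  then have "\<ominus>\<^bsub>foliation_module W\<^esub> E = (\<lambda>f. - E f)"
    using assms by (intro minus_equality) (auto simp: fun_eq_iff)
  then show ?thesis by (simp add: a_minus_def fun_eq_iff)
qed

lemma isotropy_kernel_subset: "isotropy_kernel (vanishing_foliation W) p \<subseteq> vanishing_foliation W"
proof
  fix D assume "D \<in> isotropy_kernel (vanishing_foliation W) p"
  then show "D \<in> vanishing_foliation W"
    unfolding isotropy_kernel_def
    by induction (auto simp: vanishing_foliation_iff restrict_def derivations_closed derivation_mult)
qed

lemma isotropy_kernel_closed: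
  shows "(\<lambda>f. 0) \<in> isotropy_kernel (vanishing_foliation W) p"
    and "D \<in> isotropy_kernel (vanishing_foliation W) p \<Longrightarrow>
      (\<lambda>f. g * D f) \<in> isotropy_kernel (vanishing_foliation W) p"
    and "\<lbrakk>D \<in> isotropy_kernel (vanishing_foliation W) p; E \<in> isotropy_kernel (vanishing_foliation W) p\<rbrakk>
      \<Longrightarrow> (\<lambda>f. D f + E f) \<in> isotropy_kernel (vanishing_foliation W) p"
    and "\<lbrakk>D \<in> isotropy_kernel (vanishing_foliation W) p; E \<in> isotropy_kernel (vanishing_foliation W) p\<rbrakk>
      \<Longrightarrow> (\<lambda>f. D f - E f) \<in> isotropy_kernel (vanishing_foliation W) p"
  unfolding isotropy_kernel_def
  using zero_vanishing_foliation[of W]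
  by (auto intro!: ideal_der_prod_zero ideal_der_prod_mult ideal_der_prod_add ideal_der_prod_diff)

lemma quotient_module_isotropy:
  "quotient_module CC (foliation_module W) (isotropy_kernel (vanishing_foliation W) p)"
proof -
  interpret module CC "foliation_module W" by (rule module_foliation)
  have "\<ominus>\<^bsub>foliation_module W\<^esub> D = (\<lambda>f. - D f)" if "D \<in> vanishing_foliation W" for D
    using foliation_module_minus[OF zero_vanishing_foliation that]
    by (simp add: a_minus_def restrict_def)
  then have "submodule (isotropy_kernel (vanishing_foliation W) p) CC (foliation_module W)"
    using isotropy_kernel_subset[of W p] isotropy_kernel_closed(4)[OF isotropy_kernel_closed(1)]
    by (intro submoduleI)
      (auto simp: isotropy_kernel_closed isotropy_kernel_subset[THEN subsetD] restrict_def)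
  then show ?thesis using module_foliation by (simp add: quotient_module_def)
qed

lemma isotropy_kernel_coset_eqI:
  assumes "D \<in> vanishing_foliation W" "E \<in> vanishing_foliation W"
    and "(\<lambda>f. D f - E f) \<in> isotropy_kernel (vanishing_foliation W) p"
  shows "isotropy_kernel (vanishing_foliation W) p +>\<^bsub>foliation_module W\<^esub> D =
    isotropy_kernel (vanishing_foliation W) p +>\<^bsub>foliation_module W\<^esub> E"
proof -
  interpret quotient_module CC "foliation_module W" "isotropy_kernel (vanishing_foliation W) p"
    by (rule quotient_module_isotropy)
  show ?thesis using assms by (subst coset_eq_iff) (simp_all add: foliation_module_minus)
qed

text \<open>For \<open>D = h Z\<close> with \<open>h \<in> \<I>\<^sub>W\<close>, the product regroups as \<open>Z(g) (h Y)\<close>, and \<open>Z(g)\<close> vanishes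
  at \<open>p\<close> by strong singularity.\<close>

lemma foliation_apply_mult_in_kernel:
  assumes p: "strongly_singular W p" and D: "D \<in> vanishing_foliation W"
    and g: "g \<in> vanishing_ideal W" and Y: "Y \<in> derivations CC poly_algebra"
  shows "(\<lambda>f. D g * Y f) \<in> isotropy_kernel (vanishing_foliation W) p"
  using D unfolding vanishing_foliation_def
proof induction
  case (prod h Z)
  have "(\<lambda>f. h * Y f) \<in> vanishing_foliation W"
    using prod Y by (simp add: vanishing_foliation_iff derivation_mult)
  moreover have "Z g \<in> vanishing_ideal {p}"
    using strongly_singular_derivation[OF p g, of Z] prod by (simp add: vanishing_ideal_def)
  ultimately have "(\<lambda>f. Z g * (h * Y f)) \<in> isotropy_kernel (vanishing_foliation W) p"
    unfolding isotropy_kernel_def by (intro ideal_der_prodI)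
  then show ?case by (simp add: vanishing_foliation_def ac_simps)
next
  case (sum D E)
  then show ?case
    using isotropy_kernel_closed(3)[OF sum.IH[folded vanishing_foliation_def]]
    by (simp add: vanishing_foliation_def distrib_right)
qed

text \<open>This is the commutativity of the isotropy Lie algebra. In coordinates, [D, E] has
  coefficients D(E x_i) - E(D x_i); as E x_i and D x_i lie in \<open>I_W\<close>, each half is an
  instance of \<open>foliation_apply_mult_in_kernel\<close> with
  \<open>Y = partial i\<close>.\<close>

lemma bracket_vanishing_foliation_in_kernel:
  assumes p: "strongly_singular W p"
    and D: "D \<in> vanishing_foliation W" and E: "E \<in> vanishing_foliation W"
  shows "(\<lambda>f. D (E f) - E (D f)) \<in> isotropy_kernel (vanishing_foliation W) p"
proof -
  let ?B = "\<lambda>f. D (E f) - E (D f)"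
  have "(\<lambda>f. D (E (var_poly i)) * partial i f - E (D (var_poly i)) * partial i f)
      \<in> isotropy_kernel (vanishing_foliation W) p" for i
    using D E
    by (intro isotropy_kernel_closed(4) foliation_apply_mult_in_kernel[OF p] partial_derivation)
      (simp_all add: vanishing_foliation_iff)
  then have "(\<lambda>f. \<Sum>i\<in>UNIV. ?B (var_poly i) * partial i f)
      \<in> isotropy_kernel (vanishing_foliation W) p"
    unfolding isotropy_kernel_def left_diff_distrib
    using zero_vanishing_foliation[of W] by (intro ideal_der_prod_sum) auto
  moreover have "?B \<in> derivations CC poly_algebra"
    using D E by (intro derivations_closed vanishing_foliation_derivation)
  ultimately show ?thesis by (simp only: derivation_eq_sum_partial[of ?B, symmetric])
qed

section \<open>The action on the isotropy module\<close>

text \<open>On a generator, [V, g Z] = V(g) Z + g [V, Z]. The first term has its coefficient in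
  \<open>I_p\<close> because \<open>V\<close> vanishes at \<open>p\<close>, the second because
  \<open>g\<close> already does, and [V, Z] stays in \<open>F\<close>.\<close>

lemma bracket_isotropy_kernel:
  assumes V: "V \<in> derivations CC poly_algebra" "V ` vanishing_ideal W \<subseteq> vanishing_ideal W"
    and p: "\<And>f. poly_eval (V f) p = 0"
    and D: "D \<in> isotropy_kernel (vanishing_foliation W) p"
  shows "(\<lambda>f. V (D f) - D (V f)) \<in> isotropy_kernel (vanishing_foliation W) p"
  using D unfolding isotropy_kernel_def
proof induction
  case (prod g Z)
  have "V g \<in> vanishing_ideal {p}" using p by (simp add: vanishing_ideal_def)
  then have "(\<lambda>f. V g * Z f + g * (V (Z f) - Z (V f))) \<in> isotropy_kernel (vanishing_foliation W) p"
    unfolding isotropy_kernel_def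
    by (intro ideal_der_prod_add ideal_der_prodI vanishing_foliation_bracket V prod)
  then show ?case
    by (simp add: isotropy_kernel_def derivationD[OF V(1)] algebra_simps)
next
  case (sum D E)
  then show ?case
    using isotropy_kernel_closed(3)[OF sum.IH[folded isotropy_kernel_def]]
    by (simp add: isotropy_kernel_def derivationD[OF V(1)] algebra_simps)
qed

text \<open>\<open>fixed_point\<close> constrains every representative of the coset \<rho> x [f],
  and \<open>\<rho>' x f\<close> is one of them.\<close>

lemma fixed_point_extension:
  assumes "fixed_point W L \<rho> p" "extends W L \<rho> \<rho>'" "x \<in> carrier L"
  shows "poly_eval (\<rho>' x f) p = 0"
proof -
  interpret quotient_module CC poly_algebra "vanishing_ideal W"
    by (rule quotient_module_coord_ring)
  have "\<rho> x (vanishing_ideal W +>\<^bsub>poly_algebra\<^esub> f) = vanishing_ideal W +>\<^bsub>poly_algebra\<^esub> \<rho>' x f"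
    using assms by (simp add: extends_def)
  moreover have "\<rho>' x f \<in> vanishing_ideal W +>\<^bsub>poly_algebra\<^esub> \<rho>' x f"
    by (rule a_rcos_self) simp
  moreover have "vanishing_ideal W +>\<^bsub>poly_algebra\<^esub> f \<in> carrier (coord_ring W)"
    unfolding coord_ring_def by (rule coset_closed) simp
  ultimately show ?thesis using assms(1,3) by (auto simp: fixed_point_def)
qed

text \<open>A coset is formed with the addition alone. This identifies the cosets taken in all
  vector fields, as in \<open>isotropy_action\<close> and \<open>eta_at\<close>, with those taken in
  the foliation.\<close>

lemma a_r_coset_carrier_update: "N +>\<^bsub>M\<lparr>carrier := S\<rparr>\<^esub> a = N +>\<^bsub>M\<^esub> a"
  by (simp add: a_r_coset_def')

text \<open>The action is well defined: changing the representative by \<open>k\<close> in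
  \<open>I_p F\<close> changes the bracket by [\<rho>' x, k], which lies in \<open>I_p F\<close>
  again. Hence the union in \<open>isotropy_action\<close> runs over equal cosets.\<close>

lemma isotropy_action_coset:
  assumes V: "\<rho>' x \<in> derivations CC poly_algebra" "\<rho>' x ` vanishing_ideal W \<subseteq> vanishing_ideal W"
    and p: "\<And>f. poly_eval (\<rho>' x f) p = 0" and D: "D \<in> vanishing_foliation W"
  shows "isotropy_action (vanishing_foliation W) p \<rho>' x
      (isotropy_kernel (vanishing_foliation W) p +>\<^bsub>foliation_module W\<^esub> D) =
    isotropy_kernel (vanishing_foliation W) p +>\<^bsub>foliation_module W\<^esub> (\<lambda>f. \<rho>' x (D f) - D (\<rho>' x f))"
proof -
  let ?K = "isotropy_kernel (vanishing_foliation W) p"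
  interpret quotient_module CC "foliation_module W" ?K by (rule quotient_module_isotropy)
  have "?K +>\<^bsub>foliation_module W\<^esub> (\<lambda>f. \<rho>' x (E f) - E (\<rho>' x f)) =
      ?K +>\<^bsub>foliation_module W\<^esub> (\<lambda>f. \<rho>' x (D f) - D (\<rho>' x f))"
    if E: "E \<in> ?K +>\<^bsub>foliation_module W\<^esub> D" for E
  proof -
    obtain k where k: "k \<in> ?K" "E = (\<lambda>f. k f + D f)"
      using E by (auto simp: a_r_coset_def' restrict_def)
    then have "k \<in> vanishing_foliation W" using isotropy_kernel_subset by blast
    then have "E \<in> vanishing_foliation W"
      using k(2) D by (simp add: vanishing_foliation_iff derivations_closed)
    moreover have "(\<lambda>f. (\<rho>' x (E f) - E (\<rho>' x f)) - (\<rho>' x (D f) - D (\<rho>' x f))) =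
        (\<lambda>f. \<rho>' x (k f) - k (\<rho>' x f))"
      by (simp add: k(2) derivationD[OF V(1)])
    ultimately show ?thesis
      using bracket_isotropy_kernel[OF V p k(1)] D
      by (intro isotropy_kernel_coset_eqI vanishing_foliation_bracket V) simp_all
  qed
  moreover have "D \<in> ?K +>\<^bsub>foliation_module W\<^esub> D" using D by (intro a_rcos_self) simp
  ultimately show ?thesis
    unfolding isotropy_action_def a_r_coset_carrier_update vector_fields_simps
    by (intro SUP_eq_const) blast+
qed

lemma isotropy_action_linear:
  assumes V: "\<rho>' x \<in> derivations CC poly_algebra" "\<rho>' x ` vanishing_ideal W \<subseteq> vanishing_ideal W"
    and p: "\<And>f. poly_eval (\<rho>' x f) p = 0"
  shows "isotropy_action (vanishing_foliation W) p \<rho>' x \<in> linear_maps CC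
    (isotropy (vanishing_foliation W) p) (isotropy (vanishing_foliation W) p)"
proof -
  let ?K = "isotropy_kernel (vanishing_foliation W) p"
  let ?act = "isotropy_action (vanishing_foliation W) p \<rho>' x"
  let ?c = "\<lambda>D. ?K +>\<^bsub>foliation_module W\<^esub> D"
  interpret quotient_module CC "foliation_module W" ?K by (rule quotient_module_isotropy)
  note act = isotropy_action_coset[where \<rho>' = \<rho>', OF V p]
  note bracket = vanishing_foliation_bracket[OF V]
  have add: "(\<lambda>f. D f + E f) \<in> vanishing_foliation W"
    if "D \<in> vanishing_foliation W" "E \<in> vanishing_foliation W" for D E
    using that by (simp add: vanishing_foliation_iff derivations_closed)
  have smult: "(\<lambda>f. const_poly c * D f) \<in> vanishing_foliation W"
    if "D \<in> vanishing_foliation W" for c D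
    using that by (simp add: vanishing_foliation_iff derivation_mult)
  have c_add: "?c D \<oplus>\<^bsub>quot_module (foliation_module W) ?K\<^esub> ?c E = ?c (\<lambda>f. D f + E f)"
    if "D \<in> vanishing_foliation W" "E \<in> vanishing_foliation W" for D E
    using coset_add[of D E] that by (simp add: restrict_def)
  have c_smult: "c \<odot>\<^bsub>quot_module (foliation_module W) ?K\<^esub> ?c D = ?c (\<lambda>f. const_poly c * D f)"
    if "D \<in> vanishing_foliation W" for c D
    using coset_smult[of c D] that by (simp add: restrict_def)
  show ?thesis
    unfolding isotropy_def linear_maps_def mem_Collect_eq carrier_quot_module
  proof (intro conjI ballI funcsetI)
    fix A assume "A \<in> ?c ` carrier (foliation_module W)"
    then show "?act A \<in> ?c ` carrier (foliation_module W)"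
      by (auto simp: act intro!: imageI bracket)
  next
    fix A B assume "A \<in> ?c ` carrier (foliation_module W)" "B \<in> ?c ` carrier (foliation_module W)"
    then obtain D E where D: "D \<in> vanishing_foliation W" "A = ?c D"
      and E: "E \<in> vanishing_foliation W" "B = ?c E" by auto
    show "?act (A \<oplus>\<^bsub>quot_module (foliation_module W) ?K\<^esub> B) =
        ?act A \<oplus>\<^bsub>quot_module (foliation_module W) ?K\<^esub> ?act B"
      unfolding D(2) E(2) c_add[OF D(1) E(1)] act[OF add[OF D(1) E(1)]] act[OF D(1)] act[OF E(1)]
        c_add[OF bracket[OF D(1)] bracket[OF E(1)]]
      by (simp add: derivationD[OF V(1)] algebra_simps)
  next
    fix c A assume "A \<in> ?c ` carrier (foliation_module W)"
    then obtain D where D: "D \<in> vanishing_foliation W" "A = ?c D" by auto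
    show "?act (c \<odot>\<^bsub>quot_module (foliation_module W) ?K\<^esub> A) =
        c \<odot>\<^bsub>quot_module (foliation_module W) ?K\<^esub> ?act A"
      unfolding D(2) c_smult[OF D(1)] act[OF smult[OF D(1)]] act[OF D(1)]
        c_smult[OF bracket[OF D(1)]]
      by (simp add: derivationD[OF V(1)] algebra_simps)
  qed
qed

section \<open>Comparison of a linear extension with a flat one\<close>

text \<open>Both fields induce the same derivation \<open>\<rho> x\<close> of the coordinate ring,
  so their difference takes values in \<open>I_W\<close>.\<close>

lemma extensions_difference:
  assumes \<rho>': "\<rho>' \<in> linear_maps CC L vector_fields" "extends W L \<rho> \<rho>'"
    and \<sigma>: "\<sigma> \<in> linear_maps CC L vector_fields" "extends W L \<rho> \<sigma>"
    and x: "x \<in> carrier L"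
  shows "(\<lambda>f. \<sigma> x f - \<rho>' x f) \<in> vanishing_foliation W"
proof -
  interpret quotient_module CC poly_algebra "vanishing_ideal W"
    by (rule quotient_module_coord_ring)
  have "vanishing_ideal W +>\<^bsub>poly_algebra\<^esub> \<sigma> x f = vanishing_ideal W +>\<^bsub>poly_algebra\<^esub> \<rho>' x f" for f
    using \<rho>'(2) \<sigma>(2) x by (auto simp: extends_def)
  then have "\<sigma> x f - \<rho>' x f \<in> vanishing_ideal W" for f
    by (subst (asm) coset_eq_iff) auto
  then show ?thesis
    using linear_mapsD(1)[OF \<rho>'(1) x] linear_mapsD(1)[OF \<sigma>(1) x]
    by (simp add: vanishing_foliation_iff derivations_closed)
qed

text \<open>With \<open>D = \<sigma> - \<rho>'\<close>, the flatness of \<open>\<sigma>\<close> makes the curvature of \<open>\<rho>'\<close> equal to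
  \<open>[\<rho>' x, D y] - [\<rho>' y, D x] - D [x, y] + [D x, D y]\<close>, and the last term dies in the isotropy
  module by strong singularity.\<close>

lemma eta_at_eq_coboundary:
  assumes L: "lie_algebra CC L" and \<rho>: "\<rho> \<in> lie_hom CC L (vector_fields_on W)"
    and p: "fixed_point W L \<rho> p" "strongly_singular W p"
    and \<rho>': "\<rho>' \<in> linear_maps CC L vector_fields" "extends W L \<rho> \<rho>'"
    and \<sigma>: "\<sigma> \<in> lie_hom CC L vector_fields" "extends W L \<rho> \<sigma>"
  shows "eta_at (vanishing_foliation W) p L \<rho>' =
    ce_d1 L (isotropy (vanishing_foliation W) p) (isotropy_action (vanishing_foliation W) p \<rho>')
      (\<lambda>x. isotropy_kernel (vanishing_foliation W) p +>\<^bsub>foliation_module W\<^esub> (\<lambda>f. \<sigma> x f - \<rho>' x f))"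
proof -
  let ?K = "isotropy_kernel (vanishing_foliation W) p"
  let ?act = "isotropy_action (vanishing_foliation W) p \<rho>'"
  let ?M = "quot_module (foliation_module W) ?K"
  let ?c = "\<lambda>D. ?K +>\<^bsub>foliation_module W\<^esub> D"
  define D where "D x = (\<lambda>f. \<sigma> x f - \<rho>' x f)" for x
  interpret quotient_module CC "foliation_module W" ?K by (rule quotient_module_isotropy)
  have \<sigma>_lin: "\<sigma> \<in> linear_maps CC L vector_fields"
    using \<sigma>(1) by (simp add: lie_hom_def)
  have D: "D x \<in> vanishing_foliation W" if "x \<in> carrier L" for x
    unfolding D_def using extensions_difference[OF \<rho>' \<sigma>_lin \<sigma>(2) that] .
  have der: "\<rho>' x \<in> derivations CC poly_algebra" if "x \<in> carrier L" for x
    using linear_mapsD(1)[OF \<rho>'(1) that] by simp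
  have tangent: "\<rho>' x ` vanishing_ideal W \<subseteq> vanishing_ideal W" if "x \<in> carrier L" for x
    using \<rho>'(2) that by (simp add: extends_def)
  note act = isotropy_action_coset[OF der tangent fixed_point_extension[OF p(1) \<rho>'(2)]]
  note bracket = vanishing_foliation_bracket[OF der tangent]
  have minus: "(\<lambda>f. E f - E' f) \<in> vanishing_foliation W"
    if "E \<in> vanishing_foliation W" "E' \<in> vanishing_foliation W" for E E'
    using that by (simp add: vanishing_foliation_iff derivations_closed)
  have c_minus: "?c E \<ominus>\<^bsub>?M\<^esub> ?c E' = ?c (\<lambda>f. E f - E' f)"
    if "E \<in> vanishing_foliation W" "E' \<in> vanishing_foliation W" for E E'
    using coset_minus[of E E'] that by (simp add: foliation_module_minus)
  have "?c (\<rho>' (lie_bracket L x y) \<ominus>\<^bsub>vector_fields\<^esub> lie_bracket vector_fields (\<rho>' x) (\<rho>' y)) =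
      ?act x (?c (D y)) \<ominus>\<^bsub>?M\<^esub> ?act y (?c (D x)) \<ominus>\<^bsub>?M\<^esub> ?c (D (lie_bracket L x y))"
    if x: "x \<in> carrier L" and y: "y \<in> carrier L" for x y
  proof -
    have b: "lie_bracket L x y \<in> carrier L" using L x y by (rule lie_algebra.bracket_closed)
    have flat: "\<sigma> (lie_bracket L x y) = (\<lambda>f. \<sigma> x (\<sigma> y f) - \<sigma> y (\<sigma> x f))"
      using \<sigma>(1) x y by (simp add: lie_hom_def vector_fields_simps del: Der_simps)
    \<comment> \<open>The value of the coboundary at (x, y), lifted from the isotropy quotient to a
      vector field in \<open>F\<close>.\<close>
    let ?E = "\<lambda>f. \<rho>' x (D y f) - D y (\<rho>' x f) - (\<rho>' y (D x f) - D x (\<rho>' y f)) -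
      D (lie_bracket L x y) f"
    have "(\<lambda>f. \<rho>' (lie_bracket L x y) f - (\<rho>' x (\<rho>' y f) - \<rho>' y (\<rho>' x f)) - ?E f) =
        (\<lambda>f. D x (D y f) - D y (D x f))"
      by (simp add: D_def flat derivationD[OF der[OF x]] derivationD[OF der[OF y]]
          derivationD[OF linear_mapsD(1)[OF \<sigma>_lin x, simplified]]
          derivationD[OF linear_mapsD(1)[OF \<sigma>_lin y, simplified]] algebra_simps)
    then have "?c (\<lambda>f. \<rho>' (lie_bracket L x y) f - (\<rho>' x (\<rho>' y f) - \<rho>' y (\<rho>' x f))) = ?c ?E"
      using bracket_vanishing_foliation_in_kernel[OF p(2) D[OF x] D[OF y]]
      by (intro isotropy_kernel_coset_eqI curvature_in_vanishing_foliation[OF L \<rho> \<rho>' x y]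
          minus bracket D x y b) simp
    also have "\<dots> = ?act x (?c (D y)) \<ominus>\<^bsub>?M\<^esub> ?act y (?c (D x)) \<ominus>\<^bsub>?M\<^esub> ?c (D (lie_bracket L x y))"
      by (simp add: act bracket c_minus minus D x y b)
    finally show ?thesis
      using x y
      by (simp add: vector_fields_simps vector_fields_minus derivations_closed der del: Der_simps)
  qed
  then show ?thesis
    unfolding eta_at_def ce_d1_def isotropy_def
    by (auto simp: D_def a_r_coset_carrier_update fun_eq_iff restrict_def simp del: Der_simps)
qed

text \<open>The contrapositive of the second claim. With the primitive from
  \<open>eta_at_eq_coboundary\<close> at hand, what remains is linearity of that primitive and of
  the action.\<close>

lemma obstruction_class_eq_zero:
  assumes L: "lie_algebra CC L" and \<rho>: "\<rho> \<in> lie_hom CC L (vector_fields_on W)"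
    and p: "fixed_point W L \<rho> p" "strongly_singular W p"
    and \<rho>': "\<rho>' \<in> linear_maps CC L vector_fields" "extends W L \<rho> \<rho>'"
    and \<sigma>: "\<sigma> \<in> lie_hom CC L vector_fields" "extends W L \<rho> \<sigma>"
  shows "obstruction_class (vanishing_foliation W) p L \<rho>' =
    \<zero>\<^bsub>isotropy_H2 (vanishing_foliation W) p L \<rho>'\<^esub>"
proof -
  let ?K = "isotropy_kernel (vanishing_foliation W) p"
  let ?D = "\<lambda>x f. \<sigma> x f - \<rho>' x f"
  interpret L: lie_algebra CC L by (rule L)
  interpret quotient_module CC "foliation_module W" ?K by (rule quotient_module_isotropy)
  have \<sigma>_lin: "\<sigma> \<in> linear_maps CC L vector_fields"
    using \<sigma>(1) by (simp add: lie_hom_def)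
  have D: "?D x \<in> vanishing_foliation W" if "x \<in> carrier L" for x
    using extensions_difference[OF \<rho>' \<sigma>_lin \<sigma>(2) that] .
  \<comment> \<open>The primitive is linear because \<sigma>, \<rho>' and the projection to the
    quotient are.\<close>
  have coset: "(\<lambda>x. ?K +>\<^bsub>foliation_module W\<^esub> ?D x) \<in>
      linear_maps CC L (isotropy (vanishing_foliation W) p)"
    unfolding isotropy_def linear_maps_def
  proof (intro CollectI conjI ballI funcsetI)
    fix x y assume x: "x \<in> carrier L" and y: "y \<in> carrier L"
    have "?D (x \<oplus>\<^bsub>L\<^esub> y) = ?D x \<oplus>\<^bsub>foliation_module W\<^esub> ?D y"
      using linear_mapsD(2)[OF \<rho>'(1) x y] linear_mapsD(2)[OF \<sigma>_lin x y]
      by (simp add: restrict_def algebra_simps)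
    then show "?K +>\<^bsub>foliation_module W\<^esub> ?D (x \<oplus>\<^bsub>L\<^esub> y) = (?K +>\<^bsub>foliation_module W\<^esub> ?D x)
        \<oplus>\<^bsub>quot_module (foliation_module W) ?K\<^esub> (?K +>\<^bsub>foliation_module W\<^esub> ?D y)"
      using D[OF x] D[OF y] coset_add[of "?D x" "?D y"] by simp
  next
    fix c x assume c: "c \<in> carrier CC" and x: "x \<in> carrier L"
    have "?D (c \<odot>\<^bsub>L\<^esub> x) = c \<odot>\<^bsub>foliation_module W\<^esub> ?D x"
      using linear_mapsD(3)[OF \<rho>'(1) c x] linear_mapsD(3)[OF \<sigma>_lin c x]
      by (simp add: restrict_def right_diff_distrib)
    then show "?K +>\<^bsub>foliation_module W\<^esub> ?D (c \<odot>\<^bsub>L\<^esub> x) =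
        c \<odot>\<^bsub>quot_module (foliation_module W) ?K\<^esub> (?K +>\<^bsub>foliation_module W\<^esub> ?D x)"
      using coset_smult[OF c, of "?D x"] D[OF x] by simp
  qed (use D in auto)
  have act: "isotropy_action (vanishing_foliation W) p \<rho>' x \<in> linear_maps CC
      (isotropy (vanishing_foliation W) p) (isotropy (vanishing_foliation W) p)"
    if x: "x \<in> carrier L" for x
  proof (rule isotropy_action_linear)
    show "\<rho>' x \<in> derivations CC poly_algebra"
      using linear_mapsD(1)[OF \<rho>'(1) x] by simp
    show "\<rho>' x ` vanishing_ideal W \<subseteq> vanishing_ideal W"
      using \<rho>'(2) x by (simp add: extends_def)
  qed (rule fixed_point_extension[OF p(1) \<rho>'(2) x])
  show ?thesis
    unfolding obstruction_class_def isotropy_H2_def zero_ce_H2 eta_at_eq_coboundary[OF assms]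
    by (intro ce_class2_coboundary L act coset) (simp add: isotropy_def module_quot_module)
qed

theorem corollary4p12:
  fixes W :: "(complex ^ 'n::finite) set"
    and L :: "(complex, 'g) lie_struct"
    and \<rho> :: "'g \<Rightarrow> 'n cpoly set \<Rightarrow> 'n cpoly set"
  assumes "affine_variety W"
    and "lie_algebra CC L"
    and "\<rho> \<in> lie_hom CC L (vector_fields_on W)"
  shows "(\<forall>\<rho>' \<in> linear_maps CC L vector_fields.
            extends W L \<rho> \<rho>' \<longrightarrow> weak_symmetry_action L (vanishing_foliation W) \<rho>')
    \<and> (\<forall>p. fixed_point W L \<rho> p \<and> strongly_singular W p \<longrightarrow>
          (\<forall>\<rho>' \<in> linear_maps CC L vector_fields. extends W L \<rho> \<rho>' \<longrightarrow>
             obstruction_class (vanishing_foliation W) p L \<rho>'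
               \<noteq> \<zero>\<^bsub>isotropy_H2 (vanishing_foliation W) p L \<rho>'\<^esub> \<longrightarrow>
             \<not> (\<exists>\<sigma> \<in> lie_hom CC L vector_fields. extends W L \<rho> \<sigma>)))"
  using extension_weak_symmetry_action[OF assms(2,3)] obstruction_class_eq_zero[OF assms(2,3)]
  by blast

end
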